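(* For every $\epsilon>0$ there exist $\delta=\delta(\epsilon)>0$, $K_0=K_0(\epsilon)$ and a constant $C(\epsilon)>0$ such that the following holds for every integer $K\ge K_0$ and every dictionary $\mathcal{D}=\{\phi_i\}_{i=1}^N$ in $\mathbb{R}^M$ with $\delta^{RIP}_{2K}(\mathcal{D})<\delta$. Let $T\subset\{1,\dots,N\}$ with $|T|=K$ and let $f_0=\sum_{i\in T}x_i\phi_i$, where the coefficients $x_i$, $i\in T$, are independent random variables uniformly distributed on $[-1,1]$. Then the residual of the Orthogonal Matching Pursuit applied to $f_0$ with respect to $\mathcal{D}$ satisfies $f_{\lceil K(1+\epsilon)\rceil}=0$ with probability greater than $1-\exp(-C(\epsilon)K)$.
   Context: A dictionary $\mathcal{D}=\{\phi_i\}_{i=1}^N$ in $\mathbb{R}^M$ ($M<N$) is a set of vectors of unit Euclidean norm whose span is $\mathbb{R}^M$. $\Phi$ denotes the $M\times N$ matrix whose $i$-th column is $\phi_i$. A vector in $\mathbb{R}^N$ is $S$-sparse if it has at most $S$ nonzero coordinates. The isometric constant $\delta^{RIP}_S(\mathcal{D})$ is the minimum of all $\delta$ such that $(1-\delta)\|\mathbf{x}\|^2\le\|\Phi\mathbf{x}\|^2\le(1+\delta)\|\mathbf{x}\|^2$ for all $S$-sparse $\mathbf{x}\in\mathbb{R}^N$ (Euclidean norms). Orthogonal Matching Pursuit (OMP): given $f_0$, for each $m\ge1$: (1) choose any $\varphi_m\in\mathcal{D}$ with $|\langle f_{m-1},\varphi_m\rangle|=\sup_{g\in\mathcal{D}}|\langle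 f_{m-1},g\rangle|$; (2) let $H_m=\operatorname{span}(\varphi_1,\dots,\varphi_m)$ and let $G_m$ be the orthogonal projection of $f_0$ onto $H_m$; (3) set $f_m=f_0-G_m$. Once a residual is $0$, all later residuals are $0$. The statement is for any choice of maximizers in step (1). *)

theory Defs
  imports "HOL-Probability.Probability" "Jordan_Normal_Form.VS_Connect"
begin

unbundle no inner_syntax

text \<open>
  The dimensions are quantified inside the theorem, so vectors and matrices are those of
  \<^theory>\<open>Jordan_Normal_Form.Matrix\<close>, with dimensions given by carriers. Indices start at 0.
\<close>

definition eucl_norm :: "real vec \<Rightarrow> real" where
  "eucl_norm v = sqrt (v \<bullet> v)"

definition span_vec :: "nat \<Rightarrow> real vec set \<Rightarrow> real vec set" where
  "span_vec M W = LinearCombinations.module.span class_ring (module_vec TYPE(real) M) W"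

text \<open>
  A dictionary \<open>{\<phi>\<^sub>0, \<dots>, \<phi>\<^sub>N\<^sub>-\<^sub>1}\<close> in \<open>\<real>\<^sup>M\<close> is given by the matrix with columns \<open>\<phi>\<^sub>i = col \<Phi> i\<close>.
\<close>

definition dictionary :: "nat \<Rightarrow> nat \<Rightarrow> real mat \<Rightarrow> bool" where
  "dictionary M N \<Phi> \<longleftrightarrow>
     M < N \<and> \<Phi> \<in> carrier_mat M N \<and>
     (\<forall>i<N. eucl_norm (col \<Phi> i) = 1) \<and>
     span_vec M (set (cols \<Phi>)) = carrier_vec M"

definition sparse_vec :: "nat \<Rightarrow> real vec \<Rightarrow> bool" where
  "sparse_vec S x \<longleftrightarrow> card {i. i < dim_vec x \<and> x $ i \<noteq> 0} \<le> S"

definition rip_const :: "nat \<Rightarrow> real mat \<Rightarrow> real" where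
  "rip_const S \<Phi> = (LEAST \<delta>. \<forall>x \<in> carrier_vec (dim_col \<Phi>). sparse_vec S x \<longrightarrow>
     (1 - \<delta>) * (eucl_norm x)\<^sup>2 \<le> (eucl_norm (\<Phi> *\<^sub>v x))\<^sup>2 \<and>
     (eucl_norm (\<Phi> *\<^sub>v x))\<^sup>2 \<le> (1 + \<delta>) * (eucl_norm x)\<^sup>2)"

definition is_orth_proj :: "real vec set \<Rightarrow> real vec \<Rightarrow> real vec \<Rightarrow> bool" where
  "is_orth_proj H v g \<longleftrightarrow> g \<in> H \<and> (\<forall>h\<in>H. (v - g) \<bullet> h = 0)"

text \<open>
  \<open>omp_run \<Phi> f0 \<phi> f\<close>: the selected elements \<open>\<phi> 1, \<phi> 2, \<dots>\<close> and the residuals \<open>f 0, f 1, \<dots>\<close>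
  are a possible run on \<open>f0\<close>, for some choice of maximizers; \<open>\<phi> 0\<close> is irrelevant.
  After a zero residual any dictionary element may be selected, and all later residuals are zero.
\<close>

definition omp_run ::
  "real mat \<Rightarrow> real vec \<Rightarrow> (nat \<Rightarrow> real vec) \<Rightarrow> (nat \<Rightarrow> real vec) \<Rightarrow> bool" where
  "omp_run \<Phi> f0 \<phi> f \<longleftrightarrow>
     f 0 = f0 \<and>
     (\<forall>m\<ge>1.
        \<phi> m \<in> set (cols \<Phi>) \<and>
        \<bar>f (m - 1) \<bullet> \<phi> m\<bar> = (SUP g\<in>set (cols \<Phi>). \<bar>f (m - 1) \<bullet> g\<bar>) \<and>
        (\<exists>G. is_orth_proj (span_vec (dim_row \<Phi>) (\<phi> ` {1..m})) f0 G \<and> f m = f0 - G))"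

definition synth :: "real mat \<Rightarrow> nat set \<Rightarrow> (nat \<Rightarrow> real) \<Rightarrow> real vec" where
  "synth \<Phi> T x = finsum_vec TYPE(real) (dim_row \<Phi>) (\<lambda>i. x i \<cdot>\<^sub>v col \<Phi> i) T"

text \<open>
  The joint law of independent coefficients \<open>x\<^sub>i\<close>, \<open>i \<in> T\<close>, uniform on \<open>[-1,1]\<close>; the lemma
  below shows that any such family, on any probability space, has this joint law.
\<close>

definition unif_coeffs :: "nat set \<Rightarrow> (nat \<Rightarrow> real) measure" where
  "unif_coeffs T = (\<Pi>\<^sub>M i\<in>T. uniform_measure lborel {-1..1})"

lemma distr_indep_uniform_eq_unif_coeffs:
  assumes "prob_space P" "T \<noteq> {}"
    and "prob_space.indep_vars P (\<lambda>_. borel) X T"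
    and "\<And>i. i \<in> T \<Longrightarrow> distr P borel (X i) = uniform_measure lborel {-1..1}"
  shows "distr P (\<Pi>\<^sub>M i\<in>T. borel) (\<lambda>\<omega>. \<lambda>i\<in>T. X i \<omega>) = unif_coeffs T"
proof -
  interpret prob_space P by fact
  have rv: "random_variable borel (X i)" if "i \<in> T" for i
    using assms(3) that by (auto simp: indep_vars_def)
  have "distr P (\<Pi>\<^sub>M i\<in>T. borel) (\<lambda>\<omega>. \<lambda>i\<in>T. X i \<omega>) = (\<Pi>\<^sub>M i\<in>T. distr P borel (X i))"
    using indep_vars_iff_distr_eq_PiM'[where X = X and M' = "\<lambda>_. borel" and I = T] assms(2,3) rv
    by simp
  also have "\<dots> = unif_coeffs T"
    unfolding unif_coeffs_def by (rule PiM_cong) (use assms(4) in auto)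
  finally show ?thesis .
qed

end

theory Submission
  imports Defs
begin

text \<open>
  Everything depends on the Gram matrix only. Let \<open>\<Gamma>\<close> be the set of indices in \<open>T\<close> that are not
  selected yet. By the restricted isometry property the energy \<open>E = \<parallel>f\<^sub>m\<parallel>\<^sup>2\<close> of the residual is
  \<open>\<parallel>x\<^sub>\<Gamma>\<parallel>\<^sup>2\<close> up to a factor \<open>1 \<plusminus> \<delta>\<close>, and each iteration lowers it by at least the square of the
  maximal correlation. With \<open>b\<^sub>0 \<ge> b\<^sub>1 \<ge> \<dots>\<close> the sorted moduli of the coefficients, the maximal
  correlation after \<open>g\<close> correct selections is nearly at least \<open>b\<^sub>g\<^sub>+\<^sub>q\<close> for \<open>q\<close> a small multiple of \<open>K\<close>.
  The correct selections thus consume nearly the whole energy, while every wrong one costs at least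
  about \<open>a\<^sup>2\<close> as long as the coefficients below \<open>a\<close> are less than a small fraction of \<open>K\<close>, which holds
  up to exponentially small probability; so there are few wrong selections until only a small
  fraction of \<open>T\<close> is missing. From then on, \<open>k\<close> missing indices are found deterministically within
  \<open>128 k\<close> further iterations (as in T. Zhang's analysis of OMP).
\<close>

subsection \<open>Finite sums of sorted reals\<close>

lemma Diff_Diff_Int_superset: "A \<subseteq> B \<Longrightarrow> T - A - ((T - A) \<inter> B) = T - B"
  by blast

text \<open>Exchange argument: \<open>S - {..<card S}\<close> and \<open>{..<card S} - S\<close>
  have equal size, and the value \<open>b (card S)\<close> bounds \<open>b\<close> from above on the
  former and from below on the latter.\<close>

lemma sum_antimono_le_sum_initial:
  fixes b :: "nat \<Rightarrow> real"
  assumes S: "S \<subseteq> {..<n}" and anti: "\<And>i j. i \<le> j \<Longrightarrow> j < n \<Longrightarrow> b j \<le> b i"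
  shows "sum b S \<le> sum b {..<card S}"
\<comment> \<open>The separating value \<open>b (card S)\<close> is covered by \<open>anti\<close>
  only if \<open>card S < n\<close>.\<close>
proof (cases "card S = n")
  case True
  then have "S = {..<n}" using S by (simp add: card_subset_eq)
  then show ?thesis by simp
next
  case False
  have fin: "finite S" using S finite_subset by blast
  have "card S < n" using False S card_mono[OF finite_lessThan S] by simp
  let ?I = "{..<card S}"
  let ?v = "b (card S)"
  have c: "card (S - ?I) = card (?I - S)"
    using fin card_Diff_subset_Int[of S ?I] card_Diff_subset_Int[of ?I S] by (simp add: Int_commute)
  have "sum b (S - ?I) \<le> real (card (S - ?I)) * ?v"
    by (rule sum_bounded_above) (use S anti in auto)
  also have "\<dots> = real (card (?I - S)) * ?v" by (simp add: c)
  also have "\<dots> \<le> sum b (?I - S)"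
    by (rule sum_bounded_below) (use \<open>card S < n\<close> anti in auto)
  finally have "sum b (S - ?I) \<le> sum b (?I - S)" .
  moreover have "sum b S = sum b (S - ?I) + sum b (S \<inter> ?I)"
    using fin by (metis add.commute sum.Int_Diff)
  moreover have "sum b ?I = sum b (?I - S) + sum b (?I \<inter> S)"
    by (metis add.commute sum.Int_Diff finite_lessThan)
  ultimately show ?thesis by (simp add: Int_commute)
qed


lemma ex_antimono_enumeration:
  fixes f :: "nat \<Rightarrow> real"
  assumes "finite T"
  obtains e where "bij_betw e {..<card T} T"
    "\<And>i j. i \<le> j \<Longrightarrow> j < card T \<Longrightarrow> f (e j) \<le> f (e i)"
proof
  define xs where "xs = sort_key (\<lambda>i. - f i) (sorted_list_of_set T)"
  have len: "length xs = card T" by (simp add: xs_def)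
  have "set xs = T" "distinct xs" using assms by (auto simp: xs_def)
  then show "bij_betw ((!) xs) {..<card T} T" by (intro bij_betw_nth) (auto simp: len)
  fix i j :: nat assume "i \<le> j" "j < card T"
  moreover have "sorted (map (\<lambda>i. - f i) xs)" by (simp add: xs_def)
  ultimately have "- f (xs ! i) \<le> - f (xs ! j)"
    using sorted_nth_mono[of "map (\<lambda>i. - f i) xs" i j] len by simp
  then show "f (xs ! j) \<le> f (xs ! i)" by simp
qed

lemma sum_lessThan_add:
  fixes f :: "nat \<Rightarrow> 'a::comm_monoid_add"
  shows "sum f {..<m + n} = sum f {..<m} + (\<Sum>j<n. f (m + j))"
  by (induction n) (simp_all add: add.assoc)

subsection \<open>OMP in terms of the Gram matrix\<close>

text \<open>For \<open>G\<close> the Gram matrix of the dictionary this is the inner product of the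
  combination with coefficients \<open>d\<close> and the \<open>j\<close>-th element;
  \<open>gram_form\<close> is the inner product of two combinations.\<close>

definition gram_corr :: "(nat \<Rightarrow> nat \<Rightarrow> real) \<Rightarrow> nat \<Rightarrow> (nat \<Rightarrow> real) \<Rightarrow> nat \<Rightarrow> real" where
  "gram_corr G N d j = (\<Sum>i<N. d i * G i j)"

definition gram_form :: "(nat \<Rightarrow> nat \<Rightarrow> real) \<Rightarrow> nat \<Rightarrow> (nat \<Rightarrow> real) \<Rightarrow> (nat \<Rightarrow> real) \<Rightarrow> real" where
  "gram_form G N d e = (\<Sum>j<N. e j * gram_corr G N d j)"

text \<open>
  \<open>c m\<close> are coefficients of the \<open>m\<close>-th residual with respect to the dictionary, \<open>idx m\<close> is the index
  selected in iteration \<open>m \<ge> 1\<close>, and \<open>x\<close> is extended by zero outside \<open>T\<close>.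
\<close>

locale gram_omp =
  fixes G :: "nat \<Rightarrow> nat \<Rightarrow> real" and N K :: nat and \<delta> :: real
    and T :: "nat set" and x :: "nat \<Rightarrow> real"
    and idx :: "nat \<Rightarrow> nat" and c :: "nat \<Rightarrow> nat \<Rightarrow> real"
  assumes G_sym: "G i j = G j i"
    and G_diag: "i < N \<Longrightarrow> G i i = 1"
    and form_nonneg: "gram_form G N d d \<ge> 0"
    and rip: "card {i. i < N \<and> d i \<noteq> 0} \<le> 2 * K \<Longrightarrow>
        (1 - \<delta>) * (\<Sum>i<N. (d i)\<^sup>2) \<le> gram_form G N d d \<and> gram_form G N d d \<le> (1 + \<delta>) * (\<Sum>i<N. (d i)\<^sup>2)"
    and delta: "0 \<le> \<delta>" "\<delta> \<le> 1 / 4"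
    and T: "T \<subseteq> {..<N}" "card T = K"
    and x_outside: "i \<notin> T \<Longrightarrow> x i = 0"
    and idx: "m \<ge> 1 \<Longrightarrow> idx m < N"
    and coeff_kept: "i \<notin> idx ` {Suc 0..m} \<Longrightarrow> c m i = x i"
    and residual_orth: "i \<in> idx ` {Suc 0..m} \<Longrightarrow> gram_corr G N (c m) i = 0"
    and corr_max: "j < N \<Longrightarrow> \<bar>gram_corr G N (c m) j\<bar> \<le> \<bar>gram_corr G N (c m) (idx (Suc m))\<bar>"
begin

abbreviation "corr \<equiv> gram_corr G N"
abbreviation "form \<equiv> gram_form G N"

text \<open>A set, so repeated selections count once; a repetition can occur only when all
  correlations vanish.\<close>

definition sel :: "nat \<Rightarrow> nat set" where
  "sel m = idx ` {Suc 0..m}"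

abbreviation "energy m \<equiv> form (c m) (c m)"

lemma finite_T: "finite T"
  using T(1) finite_subset by blast

lemma c_unselected: "i \<notin> sel m \<Longrightarrow> c m i = x i"
  using coeff_kept by (simp add: sel_def)

lemma corr_selected: "i \<in> sel m \<Longrightarrow> corr (c m) i = 0"
  using residual_orth by (simp add: sel_def)

lemma finite_sel [simp]: "finite (sel m)"
  by (simp add: sel_def)

lemma sel_0 [simp]: "sel 0 = {}"
  by (simp add: sel_def)

lemma sel_Suc: "sel (Suc m) = insert (idx (Suc m)) (sel m)"
  by (simp add: sel_def atLeastAtMostSuc_conv)

lemma sel_mono: "m \<le> n \<Longrightarrow> sel m \<subseteq> sel n"
  by (auto simp: sel_def)

section \<open>Bilinearity of the Gram form and decrease of the energy\<close>

lemma corr_add_scaled: "corr (\<lambda>i. a i + t * b i) j = corr a j + t * corr b j"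
  unfolding gram_corr_def by (simp add: algebra_simps sum.distrib sum_distrib_left)

lemma form_commute: "form a b = form b a"
proof -
  have "form a b = (\<Sum>j<N. \<Sum>i<N. b j * a i * G i j)"
    unfolding gram_form_def gram_corr_def by (simp add: sum_distrib_left mult.assoc)
  also have "\<dots> = (\<Sum>i<N. \<Sum>j<N. b j * a i * G i j)"
    by (rule sum.swap)
  also have "\<dots> = form b a"
    unfolding gram_form_def gram_corr_def
    by (intro sum.cong refl) (simp add: sum_distrib_left G_sym[of _ "_::nat"] mult_ac)
  finally show ?thesis .
qed

lemma form_add_scaled_left: "form (\<lambda>i. a i + t * b i) d = form a d + t * form b d"
  unfolding gram_form_def corr_add_scaled by (simp add: algebra_simps sum.distrib sum_distrib_left)

lemma form_add_scaled_right: "form d (\<lambda>i. a i + t * b i) = form d a + t * form d b"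
  using form_add_scaled_left form_commute by metis

lemma form_square:
  "form (\<lambda>i. a i + t * b i) (\<lambda>i. a i + t * b i) = form a a + 2 * t * form a b + t\<^sup>2 * form b b"
  by (simp add: form_add_scaled_left form_add_scaled_right form_commute[of b a]
      power2_eq_square algebra_simps)

lemma form_selected:
  assumes "\<And>j. j < N \<Longrightarrow> d j \<noteq> 0 \<Longrightarrow> j \<in> sel m"
  shows "form (c m) d = 0"
  unfolding gram_form_def using assms corr_selected by (intro sum.neutral) fastforce

text \<open>Pythagoras: \<open>d - c m\<close> is supported on selected indices, hence orthogonal to
  the residual. Any such \<open>d\<close> is a competitor; \<open>energy_Suc\<close> and
  \<open>energy_upper\<close> follow by choosing one.\<close>

lemma energy_le:
  assumes "\<And>j. j < N \<Longrightarrow> j \<notin> sel m \<Longrightarrow> d j = c m j"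
  shows "energy m \<le> form d d"
proof -
  define w where "w i = d i - c m i" for i
  have "form (c m) w = 0"
    using assms by (intro form_selected) (auto simp: w_def)
  moreover have "d = (\<lambda>i. c m i + 1 * w i)"
    by (auto simp: w_def)
  ultimately have "form d d = energy m + form w w"
    using form_square[of "c m" 1 w] by simp
  then show ?thesis using form_nonneg[of w] by simp
qed

text \<open>The competitor drops the component of the residual along the newly selected unit vector,
  which lowers the energy by exactly the squared correlation; the new projection can only do
  better.\<close>

lemma energy_Suc: "energy (Suc m) \<le> energy m - (corr (c m) (idx (Suc m)))\<^sup>2"
proof -
  let ?i = "idx (Suc m)"
  define e where "e j = (if j = ?i then 1 else 0 :: real)" for j
  define t where "t = corr (c m) ?i"
  have i: "?i < N" using idx by simp
  have fe: "form d e = corr d ?i" for d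
    using i unfolding gram_form_def e_def by (simp add: sum.delta' if_distrib[of "\<lambda>x. x * _"] cong: if_cong)
  have "corr e ?i = 1"
    using i G_diag[OF i] unfolding gram_corr_def e_def
    by (simp add: sum.delta' if_distrib[of "\<lambda>x. x * _"] cong: if_cong)
  then have "form (\<lambda>j. c m j + (- t) * e j) (\<lambda>j. c m j + (- t) * e j) = energy m - t\<^sup>2"
    unfolding form_square fe t_def[symmetric] by (simp add: power2_eq_square)
  moreover have "energy (Suc m) \<le> form (\<lambda>j. c m j + (- t) * e j) (\<lambda>j. c m j + (- t) * e j)"
  proof (rule energy_le)
    fix j assume "j \<notin> sel (Suc m)"
    then have "j \<noteq> ?i" "c m j = x j" "c (Suc m) j = x j"
      by (auto simp: sel_Suc c_unselected)
    then show "c m j + (- t) * e j = c (Suc m) j" by (simp add: e_def)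
  qed
  ultimately show ?thesis by (simp add: t_def)
qed

lemma energy_antimono: "m \<le> n \<Longrightarrow> energy n \<le> energy m"
proof (induction n rule: dec_induct)
  case (step n)
  then show ?case using energy_Suc[of n] zero_le_power2[of "corr (c n) (idx (Suc n))"] by linarith
qed simp

section \<open>Restricted isometry bounds on the energy\<close>

lemma sum_T_conv:
  assumes "A \<subseteq> {..<N}" "\<And>i. i < N \<Longrightarrow> i \<notin> A \<Longrightarrow> d i = (0::real)"
  shows "(\<Sum>i<N. (d i)\<^sup>2) = (\<Sum>i\<in>A. (d i)\<^sup>2)"
  using assms by (intro sum.mono_neutral_right) auto

lemma form_upper:
  assumes "A \<subseteq> T"
  shows "form (\<lambda>i. if i \<in> A then d i else 0) (\<lambda>i. if i \<in> A then d i else 0) \<le> (1 + \<delta>) * (\<Sum>i\<in>A. (d i)\<^sup>2)"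
proof -
  let ?d = "\<lambda>i. if i \<in> A then d i else 0"
  have "card {i. i < N \<and> ?d i \<noteq> 0} \<le> card T"
    using assms finite_T by (intro card_mono) (auto split: if_splits)
  then have "form ?d ?d \<le> (1 + \<delta>) * (\<Sum>i<N. (?d i)\<^sup>2)"
    using rip[of ?d] T(2) by auto
  also have "(\<Sum>i<N. (?d i)\<^sup>2) = (\<Sum>i\<in>A. (?d i)\<^sup>2)"
    using assms T(1) by (intro sum_T_conv) auto
  finally show ?thesis by simp
qed

lemma energy_upper: "energy m \<le> (1 + \<delta>) * (\<Sum>i\<in>T - sel m. (x i)\<^sup>2)"
proof -
  have "energy m \<le> form (\<lambda>i. if i \<in> T - sel m then x i else 0) (\<lambda>i. if i \<in> T - sel m then x i else 0)"
    by (rule energy_le) (auto simp: c_unselected x_outside)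
  also have "\<dots> \<le> (1 + \<delta>) * (\<Sum>i\<in>T - sel m. (x i)\<^sup>2)"
    by (rule form_upper) auto
  finally show ?thesis .
qed

text \<open>The shift \<open>v\<close> is there because the residual is later tested against a sign
  vector on \<open>T\<close>; the cardinality hypothesis keeps \<open>c m + v\<close> within
  sparsity \<open>2 * K\<close>.\<close>

lemma form_lower:
  assumes "card (T \<union> sel m) \<le> 2 * K" "\<And>i. i \<notin> T \<Longrightarrow> v i = 0"
  shows "(1 - \<delta>) * (\<Sum>i\<in>T - sel m. (x i + v i)\<^sup>2) \<le> form (\<lambda>i. c m i + v i) (\<lambda>i. c m i + v i)"
proof -
  let ?d = "\<lambda>i. c m i + v i"
  have supp: "?d i = 0" if "i \<notin> T \<union> sel m" for i
    using that by (simp add: assms(2) x_outside c_unselected)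
  have "card {i. i < N \<and> ?d i \<noteq> 0} \<le> card (T \<union> sel m)"
    using finite_T supp by (intro card_mono) auto
  then have *: "(1 - \<delta>) * (\<Sum>i<N. (?d i)\<^sup>2) \<le> form ?d ?d"
    using rip[of ?d] assms(1) by auto
  have "(\<Sum>i\<in>T - sel m. (x i + v i)\<^sup>2) = (\<Sum>i\<in>T - sel m. (?d i)\<^sup>2)"
    by (intro sum.cong) (auto simp: c_unselected)
  also have "\<dots> \<le> (\<Sum>i<N. (?d i)\<^sup>2)"
    using T(1) by (intro sum_mono2) auto
  finally have "(1 - \<delta>) * (\<Sum>i\<in>T - sel m. (x i + v i)\<^sup>2) \<le> (1 - \<delta>) * (\<Sum>i<N. (?d i)\<^sup>2)"
    using delta by (intro mult_left_mono) auto
  with * show ?thesis by linarith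
qed

lemma energy_lower:
  "card (T \<union> sel m) \<le> 2 * K \<Longrightarrow> (1 - \<delta>) * (\<Sum>i\<in>T - sel m. (x i)\<^sup>2) \<le> energy m"
  using form_lower[of m "\<lambda>_. 0"] by simp

section \<open>Geometric decay of the energy\<close>

text \<open>When the part of \<open>x\<close> outside \<open>A\<close> is small, at least half of
  the energy is the pairing of the residual with \<open>x\<close> on \<open>A\<close>. At most
  \<open>p\<close> coefficients are involved, so Cauchy-Schwarz forces a squared correlation of at
  least \<open>energy m / (8 * p)\<close>. The set \<open>A\<close> refers to an earlier time
  \<open>n\<close> so that it can stay fixed over many iterations.\<close>

lemma energy_contract_step:
  assumes "n \<le> m" "card (T \<union> sel m) \<le> 2 * K" "A \<subseteq> T - sel n" "card A \<le> p"
    and tail: "5 * (\<Sum>i\<in>T - sel n - A. (x i)\<^sup>2) \<le> energy m"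
  shows "energy (Suc m) \<le> (1 - 1 / (8 * p)) * energy m"
proof (cases "energy m = 0")
  case True
  then show ?thesis using energy_antimono[of m "Suc m"] by simp
next
  case False
  define E where "E = energy m"
  define \<mu> where "\<mu> = \<bar>corr (c m) (idx (Suc m))\<bar>"
  define y where "y i = (if i \<in> T - sel n - A then x i else 0)" for i
  define z where "z i = (if i \<in> A then x i else 0)" for i
  have E: "E > 0" using False form_nonneg[of "c m"] by (simp add: E_def)
  have finA: "finite A" using assms(3) finite_T finite_subset by blast
  have AN: "A \<subseteq> {..<N}" using assms(3) T(1) by auto
  \<comment> \<open>Off \<open>sel m\<close> the coefficients \<open>c m\<close> coincide with
    \<open>y + z\<close>, so the difference is orthogonal to the residual.\<close>
  have "form (c m) (\<lambda>i. c m i + (- 1) * (y i + 1 * z i)) = 0"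
  proof (rule form_selected)
    fix j assume j: "c m j + (- 1) * (y j + 1 * z j) \<noteq> 0"
    show "j \<in> sel m"
    proof (rule ccontr)
      assume "j \<notin> sel m"
      moreover from this have "j \<notin> sel n" using sel_mono[OF assms(1)] by blast
      ultimately have "c m j = y j + z j"
        using assms(3) by (auto simp: y_def z_def c_unselected x_outside)
      with j show False by simp
    qed
  qed
  then have E_eq: "E = form (c m) y + form (c m) z"
    unfolding form_add_scaled_right E_def by simp
  have "form y y \<le> (1 + \<delta>) * (\<Sum>i\<in>T - sel n - A. (x i)\<^sup>2)"
    unfolding y_def by (rule form_upper) auto
  also have "\<dots> \<le> (5 / 4) * (\<Sum>i\<in>T - sel n - A. (x i)\<^sup>2)"
    using delta by (intro mult_right_mono sum_nonneg) auto
  finally have yy: "form y y \<le> E / 4" using tail by (simp add: E_def)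
  \<comment> \<open>Nonnegativity at \<open>c m - 2 * y\<close> takes the place of Cauchy-Schwarz
    for the form: together with \<open>yy\<close> it bounds \<open>form (c m) y\<close> by
    \<open>E / 2\<close>.\<close>
  have "0 \<le> form (\<lambda>i. c m i + (- 2) * y i) (\<lambda>i. c m i + (- 2) * y i)"
    by (rule form_nonneg)
  then have "4 * form (c m) y \<le> E + 4 * form y y"
    unfolding form_square E_def by simp
  with yy E_eq have Ez: "E / 2 \<le> form (c m) z" by linarith
  let ?L = "\<Sum>i\<in>A - sel m. \<bar>x i\<bar>"
  \<comment> \<open>Correlations vanish on selected indices. The remaining coefficients are missing
    at time \<open>m\<close> itself, so \<open>energy_lower\<close> bounds their squares by the
    current energy.\<close>
  have "form (c m) z = (\<Sum>i\<in>A - sel m. x i * corr (c m) i)"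
    unfolding gram_form_def z_def using AN corr_selected
    by (intro sum.mono_neutral_cong_right) auto
  also have "\<dots> \<le> (\<Sum>i\<in>A - sel m. \<bar>x i\<bar> * \<mu>)"
  proof (rule sum_mono)
    fix i assume "i \<in> A - sel m"
    then have "i < N" using AN by auto
    then have "\<bar>x i * corr (c m) i\<bar> \<le> \<bar>x i\<bar> * \<mu>"
      unfolding abs_mult \<mu>_def by (intro mult_left_mono corr_max) auto
    then show "x i * corr (c m) i \<le> \<bar>x i\<bar> * \<mu>" by linarith
  qed
  also have "\<dots> = ?L * \<mu>" by (simp add: sum_distrib_right)
  finally have "E / 2 \<le> ?L * \<mu>" using Ez by simp
  then have "(E / 2)\<^sup>2 \<le> (?L * \<mu>)\<^sup>2" using E by (intro power_mono) auto
  then have L1: "E * E / 4 \<le> ?L\<^sup>2 * \<mu>\<^sup>2" by (simp add: power_mult_distrib power_divide flip: power2_eq_square)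
  have "?L\<^sup>2 \<le> (\<Sum>i\<in>A - sel m. \<bar>x i\<bar>\<^sup>2) * (\<Sum>i\<in>A - sel m. 1\<^sup>2)"
    using Cauchy_Schwarz_ineq_sum[of "\<lambda>i. \<bar>x i\<bar>" "\<lambda>_. 1" "A - sel m"] by simp
  also have "\<dots> \<le> (4 / 3 * E) * p"
  proof (rule mult_mono)
    have "(\<Sum>i\<in>A - sel m. \<bar>x i\<bar>\<^sup>2) \<le> (\<Sum>i\<in>T - sel m. (x i)\<^sup>2)"
      using assms(3) finite_T by (simp, intro sum_mono2) auto
    also have "\<dots> \<le> 4 / 3 * ((1 - \<delta>) * (\<Sum>i\<in>T - sel m. (x i)\<^sup>2))"
      using mult_right_mono[of "3 / 4" "1 - \<delta>" "\<Sum>i\<in>T - sel m. (x i)\<^sup>2"] delta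
      by (simp add: sum_nonneg)
    also have "\<dots> \<le> 4 / 3 * E" using energy_lower[OF assms(2)] by (simp add: E_def)
    finally show "(\<Sum>i\<in>A - sel m. \<bar>x i\<bar>\<^sup>2) \<le> 4 / 3 * E" .
    have "card (A - sel m) \<le> card A" using finA by (intro card_mono) auto
    then show "(\<Sum>i\<in>A - sel m. 1\<^sup>2) \<le> real p" using assms(4) by simp
  qed (use E in \<open>auto intro!: sum_nonneg\<close>)
  finally have "?L\<^sup>2 * \<mu>\<^sup>2 \<le> (4 / 3 * E) * p * \<mu>\<^sup>2" by (intro mult_right_mono) auto
  with L1 have "E * (E / 4) \<le> E * (4 / 3 * p * \<mu>\<^sup>2)" by (simp add: mult_ac)
  then have *: "E / 4 \<le> 4 / 3 * p * \<mu>\<^sup>2" using E by (simp only: mult_le_cancel_left_pos)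
  with E have p: "p > 0" by (cases p) auto
  have "E / 8 \<le> p * \<mu>\<^sup>2" using * E by simp
  then have "E / (8 * p) \<le> \<mu>\<^sup>2" using p by (simp add: field_simps)
  moreover have "energy (Suc m) \<le> E - \<mu>\<^sup>2"
    using energy_Suc[of m] by (simp add: E_def \<mu>_def)
  ultimately show ?thesis by (simp add: E_def algebra_simps)
qed

text \<open>Either the energy reaches the level \<open>5 * (...)\<close> at some step and stays
  below it by monotonicity, or every step contracts; \<open>32 * p\<close> factors
  \<open>1 - 1 / (8 * p)\<close> multiply to at most \<open>exp (- 4)\<close>, which is below
  \<open>1 / 16\<close>.\<close>

lemma energy_contract:
  assumes "n \<le> m" "card (T \<union> sel (m + r)) \<le> 2 * K" "A \<subseteq> T - sel n" "card A \<le> p"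
    and "1 \<le> p" "32 * p \<le> r"
  shows "energy (m + r) \<le> max (5 * (\<Sum>i\<in>T - sel n - A. (x i)\<^sup>2)) (energy m / 16)"
proof -
  let ?Y = "5 * (\<Sum>i\<in>T - sel n - A. (x i)\<^sup>2)"
  let ?\<rho> = "1 - 1 / (8 * real p)"
  have \<rho>: "0 \<le> ?\<rho>" using assms(5) by (simp add: field_simps)
  have fin: "finite (T \<union> sel l)" for l using finite_T by simp
  have "l \<le> r \<Longrightarrow> energy (m + l) \<le> max ?Y (?\<rho> ^ l * energy m)" for l
  proof (induction l)
    case (Suc l)
    show ?case
    proof (cases "?Y \<le> energy (m + l)")
      case True
      have "card (T \<union> sel (m + l)) \<le> card (T \<union> sel (m + r))"
        using Suc.prems by (intro card_mono fin Un_mono sel_mono) auto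
      then have "energy (Suc (m + l)) \<le> ?\<rho> * energy (m + l)"
        using assms True by (intro energy_contract_step[of n _ A]) auto
      moreover have "energy (m + l) \<le> ?Y \<or> energy (m + l) \<le> ?\<rho> ^ l * energy m"
        using Suc by (auto simp: max_def split: if_splits)
      moreover have "energy (Suc (m + l)) \<le> energy (m + l)" by (rule energy_antimono) simp
      moreover have "?\<rho> * energy (m + l) \<le> ?\<rho> * (?\<rho> ^ l * energy m)"
        if "energy (m + l) \<le> ?\<rho> ^ l * energy m"
        using that \<rho> by (rule mult_left_mono)
      ultimately show ?thesis by (auto simp: max_def mult.assoc)
    next
      case False
      then show ?thesis using energy_antimono[of "m + l" "m + Suc l"] by simp
    qed
  qed simp
  then have "energy (m + r) \<le> max ?Y (?\<rho> ^ r * energy m)" by simp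
  moreover have "?\<rho> ^ r \<le> 1 / 16"
  proof -
    have "?\<rho> ^ r \<le> ?\<rho> ^ (32 * p)"
      using \<rho> assms(6) by (intro power_decreasing) auto
    also have "\<dots> \<le> exp (- 1 / (8 * real p)) ^ (32 * p)"
      using exp_ge_add_one_self[of "- 1 / (8 * real p)"] by (intro power_mono \<rho>) auto
    also have "\<dots> = exp (- 4)"
      using assms(5) by (simp add: exp_of_nat_mult[symmetric])
    also have "\<dots> \<le> 1 / 16"
    proof -
      have "(2::real) ^ 4 \<le> exp 1 ^ 4" using exp_ge_add_one_self[of 1] by (intro power_mono) auto
      also have "exp 1 ^ 4 = exp (4::real)" by (simp add: exp_of_nat_mult[symmetric])
      finally show ?thesis by (simp add: exp_minus field_simps)
    qed
    finally show ?thesis .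
  qed
  then have "?\<rho> ^ r * energy m \<le> energy m / 16"
    using mult_right_mono[of "?\<rho> ^ r" "1 / 16" "energy m"] form_nonneg[of "c m"] by simp
  ultimately show ?thesis by linarith
qed


section \<open>Deterministic recovery of few missing indices\<close>

text \<open>The squared error of the best \<open>p\<close>-term approximation to the part of
  \<open>x\<close> missing at time \<open>n\<close>; minimizing over subsets avoids sorting.\<close>

definition tail :: "nat \<Rightarrow> nat \<Rightarrow> real" where
  "tail n p = Min ((\<lambda>A. \<Sum>i\<in>T - sel n - A. (x i)\<^sup>2) ` {A. A \<subseteq> T - sel n \<and> card A \<le> p})"

lemma tail_le: "A \<subseteq> T - sel n \<Longrightarrow> card A \<le> p \<Longrightarrow> tail n p \<le> (\<Sum>i\<in>T - sel n - A. (x i)\<^sup>2)"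
  unfolding tail_def using finite_T
  by (intro Min_le finite_imageI finite_subset[of "{A. A \<subseteq> T - sel n \<and> card A \<le> p}" "Pow T"]) auto

lemma tail_attained:
  obtains A where "A \<subseteq> T - sel n" "card A \<le> p" "tail n p = (\<Sum>i\<in>T - sel n - A. (x i)\<^sup>2)"
proof -
  let ?S = "{A. A \<subseteq> T - sel n \<and> card A \<le> p}"
  have "?S \<subseteq> Pow T" by auto
  then have "finite ?S" using finite_T finite_subset by blast
  moreover have "{} \<in> ?S" by simp
  ultimately have "tail n p \<in> (\<lambda>A. \<Sum>i\<in>T - sel n - A. (x i)\<^sup>2) ` ?S"
    unfolding tail_def by (intro Min_in) auto
  then show thesis using that by auto
qed

lemma tail_nonneg: "0 \<le> tail n p"
  by (rule tail_attained[of n p]) (auto intro: sum_nonneg)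

lemma tail_0: "tail n 0 = (\<Sum>i\<in>T - sel n. (x i)\<^sup>2)"
proof (rule tail_attained[of n 0])
  fix A assume "A \<subseteq> T - sel n" "card A \<le> 0" and *: "tail n 0 = (\<Sum>i\<in>T - sel n - A. (x i)\<^sup>2)"
  then have "A = {}" using finite_T finite_subset by fastforce
  then show ?thesis using * by simp
qed

lemma tail_card: "tail n (card (T - sel n)) = 0"
  using tail_le[of "T - sel n" n "card (T - sel n)"] tail_nonneg[of n "card (T - sel n)"] by simp

text \<open>
  Each scale \<open>p\<close> costs \<open>O(p)\<close> iterations: either the tail drops sharply from \<open>p div 2\<close> to \<open>p\<close>, and
  then a small residual forces more than \<open>p div 2\<close> new correct selections, or the bound on the
  residual is inherited by the next scale.
\<close>

lemma energy_tail_or_progress: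
  assumes k: "k = card (T - sel n)" and valid: "card (T \<union> sel (n + 128 * k)) \<le> 2 * K"
    and "p \<le> k"
  shows "energy (n + 64 * p) \<le> 5 * tail n p \<or>
    (\<exists>g. 1 \<le> g \<and> g \<le> k \<and> g \<le> card ((T - sel n) \<inter> sel (n + 128 * g)))"
  using \<open>p \<le> k\<close>
proof (induction p rule: less_induct)
  case (less p)
  have valid': "card (T \<union> sel m) \<le> 2 * K" if "m \<le> n + 128 * k" for m
  proof -
    have "card (T \<union> sel m) \<le> card (T \<union> sel (n + 128 * k))"
      using that finite_T by (intro card_mono Un_mono sel_mono) auto
    then show ?thesis using valid by simp
  qed
  show ?case
  proof (cases "p = 0")
    case True
    have "energy n \<le> (1 + \<delta>) * tail n 0" using energy_upper[of n] by (simp add: tail_0)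
    also have "\<dots> \<le> 5 * tail n 0" using delta tail_nonneg by (intro mult_right_mono) auto
    finally show ?thesis using True by simp
  next
    case False
    let ?h = "p div 2"
    obtain A where A: "A \<subseteq> T - sel n" "card A \<le> p" "tail n p = (\<Sum>i\<in>T - sel n - A. (x i)\<^sup>2)"
      by (rule tail_attained)
    let ?m = "n + 64 * ?h"
    have time: "?m + 64 * (p - ?h) = n + 64 * p" by simp
    \<comment> \<open>Since \<open>p - p div 2\<close> is at least \<open>p / 2\<close>, there are
      at least the \<open>32 * p\<close> iterations that \<open>energy_contract\<close> asks
      for.\<close>
    have "energy (?m + 64 * (p - ?h)) \<le> max (5 * (\<Sum>i\<in>T - sel n - A. (x i)\<^sup>2)) (energy ?m / 16)"
    proof (rule energy_contract)
      show "card (T \<union> sel (?m + 64 * (p - ?h))) \<le> 2 * K"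
        using less.prems by (intro valid') simp
    qed (use A False in auto)
    then have contract: "energy (n + 64 * p) \<le> max (5 * tail n p) (energy ?m / 16)"
      unfolding time A(3) .
    have "?h < p" "?h \<le> k" using False less.prems by auto
    from less.IH[OF this] show ?thesis
    proof
      assume IH: "energy ?m \<le> 5 * tail n ?h"
      show ?thesis
      \<comment> \<open>The threshold 10 serves both cases: below it \<open>energy ?m / 16\<close>
        is at most \<open>50 / 16\<close> times \<open>tail n p\<close>, and above it both terms of
        the maximum are at most half of \<open>tail n ?h\<close>.\<close>
      proof (cases "tail n ?h \<le> 10 * tail n p")
        case True
        then show ?thesis using contract IH tail_nonneg[of n p] by (auto simp: max_def split: if_splits)
      next
        case drop: False
        let ?g = "?h + 1"
        have gk: "?g \<le> k" using False less.prems by linarith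
        let ?B = "(T - sel n) \<inter> sel (n + 128 * ?g)"
        have "energy (n + 128 * ?g) \<le> energy (n + 64 * p)"
          by (rule energy_antimono) simp
        also have "\<dots> \<le> tail n ?h / 2" using contract IH drop tail_nonneg[of n p] by (auto simp: max_def split: if_splits)
        finally have e: "energy (n + 128 * ?g) \<le> tail n ?h / 2" .
        \<comment> \<open>With at most \<open>?h\<close> new correct selections the missing squares
          would still sum to at least \<open>tail n ?h\<close>, whereas the energy bound allows at
          most \<open>2 / 3\<close> of it.\<close>
        have "?g \<le> card ?B"
        proof (rule ccontr)
          assume "\<not> ?g \<le> card ?B"
          then have "tail n ?h \<le> (\<Sum>i\<in>T - sel n - ?B. (x i)\<^sup>2)"
            by (intro tail_le) auto
          also have "T - sel n - ?B = T - sel (n + 128 * ?g)"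
            by (rule Diff_Diff_Int_superset[OF sel_mono]) simp
          finally have *: "tail n ?h \<le> (\<Sum>i\<in>T - sel (n + 128 * ?g). (x i)\<^sup>2)" .
          have "(1 - \<delta>) * (\<Sum>i\<in>T - sel (n + 128 * ?g). (x i)\<^sup>2) \<le> tail n ?h / 2"
            using energy_lower[of "n + 128 * ?g"] valid'[of "n + 128 * ?g"] gk e by simp
          moreover have "(3 / 4) * (\<Sum>i\<in>T - sel (n + 128 * ?g). (x i)\<^sup>2)
              \<le> (1 - \<delta>) * (\<Sum>i\<in>T - sel (n + 128 * ?g). (x i)\<^sup>2)"
            using delta by (intro mult_right_mono sum_nonneg) auto
          ultimately show False using * drop tail_nonneg[of n p] by linarith
        qed
        then show ?thesis using gk by (intro disjI2 exI[of _ ?g]) simp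
      qed
    qed blast
  qed
qed

text \<open>At the scale \<open>p = k'\<close> of all missing indices the tail vanishes, so the
  first alternative gives zero energy. The second finds \<open>g\<close> missing indices within
  \<open>128 * g\<close> iterations, and the induction continues with \<open>k - g\<close> and the
  budget \<open>128 * (k - g)\<close>.\<close>

lemma energy_zero_of_few_missing:
  assumes "card (T - sel n) \<le> k" and "card (T \<union> sel (n + 128 * k)) \<le> 2 * K"
  shows "energy (n + 128 * k) = 0"
  using assms
proof (induction k arbitrary: n rule: less_induct)
  case (less k)
  define k' where "k' = card (T - sel n)"
  have valid: "card (T \<union> sel m) \<le> 2 * K" if "m \<le> n + 128 * k" for m
  proof -
    have "card (T \<union> sel m) \<le> card (T \<union> sel (n + 128 * k))"
      using that finite_T by (intro card_mono Un_mono sel_mono) auto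
    then show ?thesis using less.prems by simp
  qed
  have "k' \<le> k" using less.prems k'_def by simp
  then have "card (T \<union> sel (n + 128 * k')) \<le> 2 * K" by (intro valid) simp
  from energy_tail_or_progress[OF k'_def this order_refl]
  consider "energy (n + 64 * k') \<le> 5 * tail n k'"
    | g where "1 \<le> g" "g \<le> k'" "g \<le> card ((T - sel n) \<inter> sel (n + 128 * g))"
    by blast
  then show ?case
  proof cases
    case 1
    then have "energy (n + 64 * k') \<le> 0" using tail_card[of n] by (simp add: k'_def)
    moreover have "energy (n + 128 * k) \<le> energy (n + 64 * k')"
      using \<open>k' \<le> k\<close> by (intro energy_antimono) simp
    ultimately show ?thesis using form_nonneg[of "c (n + 128 * k)"] by linarith
  next
    case 2
    let ?n = "n + 128 * g"
    have time: "?n + 128 * (k - g) = n + 128 * k" using 2 \<open>k' \<le> k\<close> by simp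
    have "T - sel ?n = (T - sel n) - ((T - sel n) \<inter> sel ?n)"
      by (rule Diff_Diff_Int_superset[OF sel_mono, symmetric]) simp
    then have "card (T - sel ?n) = k' - card ((T - sel n) \<inter> sel ?n)"
      unfolding k'_def using finite_T by (simp add: card_Diff_subset)
    then have "card (T - sel ?n) \<le> k - g" using 2 \<open>k' \<le> k\<close> by linarith
    then have "energy (?n + 128 * (k - g)) = 0"
      using 2 \<open>k' \<le> k\<close> less.prems(2) unfolding time[symmetric] by (intro less.IH) auto
    then show ?thesis unfolding time .
  qed
qed

section \<open>Bounding the number of wrong selections\<close>

text \<open>The residual is tested against the signs \<open>v\<close> of \<open>x\<close> on
  \<open>B\<close>. Polarization, with the isometry lower bound for \<open>c m + v\<close> and upper
  bounds for \<open>c m\<close> and \<open>v\<close>, makes the pairing almost the sum of the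
  \<open>\<bar>x i\<bar>\<close> over \<open>B\<close>, while it is at most \<open>q\<close> times
  the maximal correlation. The isometry error, of order \<open>\<delta> * K\<close>, is divided by
  \<open>q\<close>, which is why \<open>q\<close> must be proportional to \<open>K\<close>.\<close>

lemma residual_corr_large:
  assumes valid: "card (T \<union> sel m) \<le> 2 * K" and abs_x: "\<And>i. \<bar>x i\<bar> \<le> 1"
    and B: "B \<subseteq> T - sel m" "card B = q" "1 \<le> q"
    and large: "\<And>i. i \<in> B \<Longrightarrow> b \<le> \<bar>x i\<bar>" and b: "b \<le> 1"
  shows "b - \<delta> * (2 + K / q) \<le> \<bar>corr (c m) (idx (Suc m))\<bar>"
proof -
  define \<mu> where "\<mu> = \<bar>corr (c m) (idx (Suc m))\<bar>"
  define v where "v i = (if i \<in> B then sgn (x i) else 0)" for i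
  define X where "X = (\<Sum>i\<in>T - sel m. (x i)\<^sup>2)"
  define V where "V = (\<Sum>i\<in>B. (sgn (x i))\<^sup>2)"
  define L where "L = (\<Sum>i\<in>B. \<bar>x i\<bar>)"
  have finG: "finite (T - sel m)" using finite_T by simp
  have B': "B \<subseteq> T" "B \<subseteq> {..<N}" using B T(1) by auto
  have "(\<Sum>i\<in>T - sel m. (x i + v i)\<^sup>2)
      = X + 2 * (\<Sum>i\<in>T - sel m. x i * v i) + (\<Sum>i\<in>T - sel m. (v i)\<^sup>2)"
    by (simp add: X_def power2_sum sum.distrib sum_distrib_left mult_ac)
  also have "(\<Sum>i\<in>T - sel m. x i * v i) = L"
    unfolding L_def v_def using finG B
    by (intro sum.mono_neutral_cong_right) (auto simp: abs_sgn)
  also have "(\<Sum>i\<in>T - sel m. (v i)\<^sup>2) = V"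
    unfolding V_def v_def using finG B by (intro sum.mono_neutral_cong_right) auto
  finally have "(\<Sum>i\<in>T - sel m. (x i + v i)\<^sup>2) = X + 2 * L + V" .
  moreover have "v i = 0" if "i \<notin> T" for i using that B' by (auto simp: v_def)
  ultimately have "(1 - \<delta>) * (X + 2 * L + V) \<le> form (\<lambda>i. c m i + v i) (\<lambda>i. c m i + v i)"
    using form_lower[OF valid, of v] by simp
  moreover have "form (\<lambda>i. c m i + v i) (\<lambda>i. c m i + v i) = energy m + 2 * form (c m) v + form v v"
    using form_square[of "c m" 1 v] by simp
  moreover have "energy m \<le> (1 + \<delta>) * X" unfolding X_def by (rule energy_upper)
  moreover have "form v v \<le> (1 + \<delta>) * V"
    unfolding V_def v_def using B' by (intro form_upper)
  ultimately have fv: "(1 - \<delta>) * (X + 2 * L + V) \<le> (1 + \<delta>) * X + 2 * form (c m) v + (1 + \<delta>) * V"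
    by simp
  have "form (c m) v = (\<Sum>i\<in>B. sgn (x i) * corr (c m) i)"
    unfolding gram_form_def v_def using B' by (intro sum.mono_neutral_cong_right) auto
  also have "\<dots> \<le> real (card B) * \<mu>"
  proof (rule sum_bounded_above)
    fix i assume "i \<in> B"
    then have "\<bar>corr (c m) i\<bar> \<le> \<mu>" unfolding \<mu>_def using B' by (intro corr_max) auto
    then show "sgn (x i) * corr (c m) i \<le> \<mu>" by (auto simp: sgn_if)
  qed
  finally have *: "form (c m) v \<le> q * \<mu>" using B by simp
  have "X \<le> real (card (T - sel m)) * 1"
    unfolding X_def using abs_x by (intro sum_bounded_above) (simp add: abs_square_le_1)
  also have "\<dots> \<le> K" using T(2) finite_T card_mono[of T "T - sel m"] by simp
  finally have X: "X \<le> K" .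
  have "V \<le> real (card B) * 1"
    unfolding V_def by (intro sum_bounded_above) (simp add: sgn_if)
  then have V: "V \<le> q" using B by simp
  have "real (card B) * b \<le> L" unfolding L_def by (intro sum_bounded_below large)
  then have L: "q * b \<le> L" using B by simp
  have "(1 - \<delta>) * (q * b) \<le> (1 - \<delta>) * L" using delta by (intro mult_left_mono L) auto
  also have "\<dots> \<le> form (c m) v + \<delta> * (X + V)" using fv by (simp add: algebra_simps)
  also have "\<dots> \<le> q * \<mu> + \<delta> * (K + q)"
    using * X V delta by (intro add_mono mult_left_mono) auto
  finally have "(1 - \<delta>) * (q * b) \<le> q * \<mu> + \<delta> * (K + q)" .
  moreover have "\<delta> * (q * b) \<le> \<delta> * (q * 1)" using delta b by (intro mult_left_mono) (auto intro: mult_left_le)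
  ultimately have "q * b \<le> q * \<mu> + \<delta> * (K + 2 * q)" by (simp add: algebra_simps)
  then have "b \<le> \<mu> + \<delta> * (K + 2 * q) / q" using B(3) by (simp add: field_simps)
  also have "\<delta> * (K + 2 * q) / q = \<delta> * (2 + K / q)" using B(3) by (simp add: field_simps)
  finally show ?thesis unfolding \<mu>_def by simp
qed

lemma card_T_union_sel: "card (T \<union> sel m) = K + card (sel m - T)"
  using card_Un_disjoint[of T "sel m - T"] finite_T T(2) by simp

lemma card_T_union_sel_add: "card (T \<union> sel (m + r)) \<le> card (T \<union> sel m) + r"
proof (induction r)
  case (Suc r)
  have "T \<union> sel (m + Suc r) = insert (idx (Suc (m + r))) (T \<union> sel (m + r))"
    using sel_Suc[of "m + r"] by simp
  then show ?case using Suc finite_T by (simp add: card_insert_if)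
qed simp

text \<open>\<open>s\<close> bounds the number of coefficients below \<open>a\<close>,
  \<open>q\<close> is the size of the test set for correlations, \<open>\<eta>\<close> the resulting
  loss, and \<open>D\<close> the admissible number of wrong selections. The phase ends as soon as
  fewer than \<open>k\<close> indices of \<open>T\<close> are missing.\<close>

lemma few_wrong_selections:
  fixes \<eta> a D :: real
  assumes abs_x: "\<And>i. \<bar>x i\<bar> \<le> 1" and small: "card {i\<in>T. \<bar>x i\<bar> < a} < s"
    and q: "1 \<le> q" "q + s \<le> k" and k: "k \<le> K"
    and \<eta>: "\<delta> * (2 + K / q) \<le> \<eta>" "\<eta> \<le> a\<^sup>2 / 4" and a: "0 < a" "a \<le> 1"
    and D: "real (q - 1) + 4 * \<eta> * K \<le> D * (a\<^sup>2 / 2)" "D + 1 \<le> K"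
  obtains m where "real m \<le> K + D" "card (T - sel m) < k" "card (sel m - T) \<le> D"
proof -
  obtain e where e: "bij_betw e {..<K} T"
    and anti: "\<And>i j. i \<le> j \<Longrightarrow> j < K \<Longrightarrow> \<bar>x (e j)\<bar> \<le> \<bar>x (e i)\<bar>"
    using ex_antimono_enumeration[OF finite_T, of "\<lambda>i. \<bar>x i\<bar>"] T(2) by metis
  define b where "b j = \<bar>x (e j)\<bar>" for j
  have b: "0 \<le> b j" "b j \<le> 1" for j using abs_x by (auto simp: b_def)
  have "K > 0" using q k by simp
  have \<eta>0: "2 * \<delta> \<le> \<eta>"
  proof -
    have "0 \<le> \<delta> * (K / q)" using delta by simp
    with \<eta>(1) show ?thesis unfolding distrib_left by linarith
  qed
  then have "\<eta> \<ge> 0" using delta by simp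
  have "a\<^sup>2 \<le> a" using a by (simp add: power2_eq_square mult_left_le)
  then have "\<eta> < a" using \<eta>(2) a by simp
  \<comment> \<open>Otherwise the at least \<open>s\<close> positions from \<open>j\<close> on would
    all carry small coefficients.\<close>
  have b_large: "a \<le> b j" if "j + s \<le> K" for j
  proof (rule ccontr)
    assume "\<not> a \<le> b j"
    then have "e ` {j..<K} \<subseteq> {i\<in>T. \<bar>x i\<bar> < a}"
      using anti e bij_betwE[OF e] by (force simp: b_def)
    then have "card (e ` {j..<K}) < s"
      using small finite_T card_mono[of "{i\<in>T. \<bar>x i\<bar> < a}" "e ` {j..<K}"] by simp
    moreover have "inj_on e {j..<K}"
      using e by (metis bij_betw_def inj_on_subset ivl_subset lessThan_atLeast0 le0 order_refl)
    ultimately show False using that by (simp add: card_image)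
  qed
  define g where "g m = card (T \<inter> sel m)" for m
  define w where "w m = card (sel m - T)" for m
  have g_le: "g m \<le> K" for m
    unfolding g_def T(2)[symmetric] using finite_T by (intro card_mono) auto
  have missing: "card (T - sel m) = K - g m" for m
    unfolding g_def T(2)[symmetric] using finite_T by (simp add: card_Diff_subset_Int)
  have card_sel: "card (sel m) = g m + w m" for m
    unfolding g_def w_def using card_Int_Diff[of "sel m" T] by (simp add: Int_commute)
  \<comment> \<open>While at least \<open>k\<close> indices are missing, every selection is new, the
    \<open>j\<close>-th correct one (from 0) costs
    \<open>(b (j + (q - 1)))\<^sup>2 - 2 * \<eta>\<close> of energy, and every wrong one costs
    \<open>a\<^sup>2 - 2 * \<eta>\<close>.\<close>
  have inv: "card (sel m) = m \<and> w m \<le> D \<and>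
      energy m \<le> energy 0 - (\<Sum>j<g m. (b (j + (q - 1)))\<^sup>2 - 2 * \<eta>) - w m * (a\<^sup>2 - 2 * \<eta>)"
    if "\<forall>m'<m. k \<le> card (T - sel m')" for m
    using that
  proof (induction m)
    case 0
    have "0 \<le> real (q - 1) + 4 * \<eta> * K" using \<open>\<eta> \<ge> 0\<close> by simp
    then have "0 \<le> D * (a\<^sup>2 / 2)" using D(1) by linarith
    then have "0 \<le> D" using a by (simp add: zero_le_mult_iff)
    then show ?case by (simp add: g_def w_def)
  next
    case (Suc m)
    then have IH: "card (sel m) = m" "w m \<le> D"
      "energy m \<le> energy 0 - (\<Sum>j<g m. (b (j + (q - 1)))\<^sup>2 - 2 * \<eta>) - w m * (a\<^sup>2 - 2 * \<eta>)"
      and "k \<le> card (T - sel m)" by auto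
    then have gq: "g m + q + s \<le> K" using missing[of m] q g_le[of m] by simp
    let ?i = "idx (Suc m)"
    define \<mu> where "\<mu> = \<bar>corr (c m) ?i\<bar>"
    let ?b = "b (g m + (q - 1))"
    \<comment> \<open>Of the \<open>g m + q\<close> largest coefficients at most \<open>g m\<close>
      are selected, so \<open>q\<close> of them are missing, each of modulus at least
      \<open>?b\<close>.\<close>
    let ?J = "{j. j < g m + q \<and> e j \<notin> sel m}"
    have valid: "card (T \<union> sel m) \<le> 2 * K"
      using IH(2) D(2) unfolding card_T_union_sel w_def by linarith
    have inj: "inj_on e {..<K}" using e by (simp add: bij_betw_def)
    have "card {j. j < g m + q \<and> e j \<in> sel m} = card (e ` {j. j < g m + q \<and> e j \<in> sel m})"
      using gq by (intro card_image[symmetric] inj_on_subset[OF inj]) auto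
    also have "\<dots> \<le> g m"
      unfolding g_def using gq bij_betwE[OF e] finite_T by (intro card_mono) (auto simp: g_def)
    finally have "g m + q \<le> card ?J + g m"
      using card_Un_Int[of ?J "{j. j < g m + q \<and> e j \<in> sel m}"]
        arg_cong[of "?J \<union> {j. j < g m + q \<and> e j \<in> sel m}" "{..<g m + q}" card]
        card_Un_le[of ?J "{j. j < g m + q \<and> e j \<in> sel m}"] by fastforce
    then obtain J where J: "J \<subseteq> ?J" "card J = q"
      using obtain_subset_with_card_n[of q ?J] by auto
    have "?b - \<delta> * (2 + K / q) \<le> \<mu>"
      unfolding \<mu>_def
    proof (rule residual_corr_large[OF valid abs_x])
      show "e ` J \<subseteq> T - sel m" using J gq bij_betwE[OF e] by auto
      show "card (e ` J) = q"
        using J gq card_image[OF inj_on_subset[OF inj, of J]] by fastforce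
      fix i assume "i \<in> e ` J"
      then obtain j where "j \<in> J" "i = e j" by auto
      moreover from this have "j \<le> g m + (q - 1)" "g m + (q - 1) < K" using J gq q by auto
      ultimately show "?b \<le> \<bar>x i\<bar>" unfolding b_def using anti by blast
    qed (use q b in auto)
    then have \<mu>: "?b - \<eta> \<le> \<mu>" using \<eta>(1) by simp
    have ab: "a \<le> ?b" using gq q by (intro b_large) simp
    have "0 < \<mu>" using \<mu> ab \<open>\<eta> < a\<close> by linarith
    then have new: "?i \<notin> sel m" using corr_selected[of ?i m] by (auto simp: \<mu>_def)
    have "(?b - \<eta>)\<^sup>2 \<le> \<mu>\<^sup>2" using \<mu> ab \<open>\<eta> < a\<close> by (intro power_mono) auto
    moreover have "?b\<^sup>2 - 2 * \<eta> \<le> (?b - \<eta>)\<^sup>2"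
    proof -
      have "?b * \<eta> \<le> 1 * \<eta>" by (intro mult_right_mono b \<open>\<eta> \<ge> 0\<close>)
      then show ?thesis unfolding power2_diff using zero_le_power2[of \<eta>] by linarith
    qed
    moreover have "energy (Suc m) \<le> energy m - \<mu>\<^sup>2" using energy_Suc[of m] by (simp add: \<mu>_def)
    ultimately have drop: "energy (Suc m) \<le> energy m - (?b\<^sup>2 - 2 * \<eta>)" by linarith
    have "a\<^sup>2 \<le> ?b\<^sup>2" using ab a by (intro power_mono) auto
    have card': "card (sel (Suc m)) = Suc m" using IH(1) new by (simp add: sel_Suc)
    have ineq: "energy (Suc m) \<le> energy 0
        - (\<Sum>j<g (Suc m). (b (j + (q - 1)))\<^sup>2 - 2 * \<eta>) - w (Suc m) * (a\<^sup>2 - 2 * \<eta>)"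
      and w_Suc: "w (Suc m) \<le> w m + 1"
    proof -
      have "?i \<in> T \<and> g (Suc m) = Suc (g m) \<and> w (Suc m) = w m \<or>
          g (Suc m) = g m \<and> w (Suc m) = Suc (w m)"
        using new finite_T by (auto simp: g_def w_def sel_Suc insert_Diff_if)
      then show "energy (Suc m) \<le> energy 0
          - (\<Sum>j<g (Suc m). (b (j + (q - 1)))\<^sup>2 - 2 * \<eta>) - w (Suc m) * (a\<^sup>2 - 2 * \<eta>)"
        "w (Suc m) \<le> w m + 1"
        using IH(3) drop \<open>a\<^sup>2 \<le> ?b\<^sup>2\<close> by (auto simp: algebra_simps)
    qed
    \<comment> \<open>Energy balance: the selected coefficients hold at most the sum of the
      \<open>?g\<close> largest squares, and the correct selections consume this sum up to the shift
      by \<open>q - 1\<close>. At most \<open>q - 1 + 4 * \<eta> * K\<close> is left to pay for the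
      wrong ones.\<close>
    have "w (Suc m) \<le> D"
    proof -
      let ?g = "g (Suc m)"
      define S where "S = (\<Sum>i\<in>T. (x i)\<^sup>2)"
      define S' where "S' = (\<Sum>i\<in>T \<inter> sel (Suc m). (x i)\<^sup>2)"
      have "S \<le> real (card T) * 1"
        unfolding S_def using abs_x by (intro sum_bounded_above) (simp add: abs_square_le_1)
      then have S: "S \<le> K" using T(2) by simp
      have "S' \<ge> 0" unfolding S'_def by (intro sum_nonneg) auto
      \<comment> \<open>The bound \<open>D\<close> is not yet known for \<open>w (Suc m)\<close>;
        \<open>w m + 1\<close> together with \<open>D + 1 \<le> K\<close> keeps the isometry
        property applicable.\<close>
      have "card (T \<union> sel (Suc m)) \<le> 2 * K"
        using w_Suc IH(2) D(2) unfolding card_T_union_sel w_def by linarith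
      then have "(1 - \<delta>) * (\<Sum>i\<in>T - sel (Suc m). (x i)\<^sup>2) \<le> energy (Suc m)"
        by (rule energy_lower)
      moreover have "S = (\<Sum>i\<in>T - sel (Suc m). (x i)\<^sup>2) + S'"
        unfolding S_def S'_def using finite_T sum.Int_Diff[of T "\<lambda>i. (x i)\<^sup>2" "sel (Suc m)"] by simp
      ultimately have "(1 - \<delta>) * (S - S') \<le> energy (Suc m)" by simp
      moreover have "energy 0 \<le> (1 + \<delta>) * S" using energy_upper[of 0] by (simp add: S_def)
      ultimately have "w (Suc m) * (a\<^sup>2 - 2 * \<eta>)
          \<le> (1 + \<delta>) * S - (1 - \<delta>) * (S - S') - (\<Sum>j<?g. (b (j + (q - 1)))\<^sup>2 - 2 * \<eta>)"
        using ineq by linarith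
      also have "\<dots> = 2 * (\<delta> * S) - \<delta> * S' + 2 * \<eta> * ?g + (S' - (\<Sum>j<?g. (b (j + (q - 1)))\<^sup>2))"
        by (simp add: sum_subtractf algebra_simps)
      finally have bound: "w (Suc m) * (a\<^sup>2 - 2 * \<eta>) \<le>
        2 * (\<delta> * S) - \<delta> * S' + 2 * \<eta> * ?g + (S' - (\<Sum>j<?g. (b (j + (q - 1)))\<^sup>2))" .
      have "S' \<le> (\<Sum>j<?g. (b j)\<^sup>2)"
      proof -
        let ?I = "{j\<in>{..<K}. e j \<in> sel (Suc m)}"
        have bij: "bij_betw e ?I (T \<inter> sel (Suc m))"
          using e by (auto simp: bij_betw_def inj_on_def)
        have "S' = (\<Sum>j\<in>?I. (b j)\<^sup>2)"
          unfolding S'_def b_def by (simp add: sum.reindex_bij_betw[OF bij, symmetric])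
        also have "\<dots> \<le> (\<Sum>j<card ?I. (b j)\<^sup>2)"
          by (intro sum_antimono_le_sum_initial[where n = K] power_mono b(1)) (auto simp: b_def anti)
        also have "card ?I = ?g" unfolding g_def by (rule bij_betw_same_card[OF bij])
        finally show ?thesis .
      qed
      \<comment> \<open>Shifting the sum by \<open>q - 1\<close> loses at most its first
        \<open>q - 1\<close> terms, each at most 1.\<close>
      moreover have "(\<Sum>j<?g. (b j)\<^sup>2) - (\<Sum>j<?g. (b (j + (q - 1)))\<^sup>2) \<le> q - 1"
      proof -
        have "(\<Sum>j<?g. (b j)\<^sup>2) \<le> (\<Sum>j<q - 1 + ?g. (b j)\<^sup>2)" by (intro sum_mono2) auto
        also have "\<dots> = (\<Sum>j<q - 1. (b j)\<^sup>2) + (\<Sum>j<?g. (b (j + (q - 1)))\<^sup>2)"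
          unfolding sum_lessThan_add by (simp add: add.commute)
        also have "(\<Sum>j<q - 1. (b j)\<^sup>2) \<le> real (card {..<q - 1}) * 1"
          using b by (intro sum_bounded_above) (simp add: power_le_one)
        finally show ?thesis by simp
      qed
      moreover have "2 * (\<delta> * S) - \<delta> * S' + 2 * \<eta> * ?g + real (q - 1) \<le> real (q - 1) + 4 * \<eta> * K"
      proof -
        have "\<delta> * S \<le> \<delta> * K" using S delta by (intro mult_left_mono) auto
        also have "\<dots> \<le> \<eta> / 2 * K" using \<eta>0 by (intro mult_right_mono) auto
        finally have "2 * (\<delta> * S) \<le> \<eta> * K" by simp
        moreover have "0 \<le> \<delta> * S'" using delta \<open>S' \<ge> 0\<close> by simp
        moreover have "\<eta> * ?g \<le> \<eta> * K" using \<open>\<eta> \<ge> 0\<close> g_le by (intro mult_left_mono) auto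
        moreover have "0 \<le> \<eta> * K" using \<open>\<eta> \<ge> 0\<close> by simp
        ultimately show ?thesis by linarith
      qed
      ultimately have "w (Suc m) * (a\<^sup>2 - 2 * \<eta>) \<le> D * (a\<^sup>2 / 2)" using bound D(1) by linarith
      moreover have "w (Suc m) * (a\<^sup>2 / 2) \<le> w (Suc m) * (a\<^sup>2 - 2 * \<eta>)"
        using \<eta>(2) by (intro mult_left_mono) auto
      ultimately have "w (Suc m) * (a\<^sup>2 / 2) \<le> D * (a\<^sup>2 / 2)" by linarith
      then show ?thesis using a by simp
    qed
    with card' ineq show ?case by simp
  qed
  \<comment> \<open>All selections so far are distinct, so their number \<open>m\<close> equals
    \<open>g m + w m\<close>, which is at most \<open>K + D\<close>.\<close>
  have "\<exists>m. real m \<le> K + D \<and> card (T - sel m) < k"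
  proof (rule ccontr)
    assume *: "\<not> ?thesis"
    let ?m = "nat \<lfloor>K + D\<rfloor>"
    have "D \<ge> 0" using inv[of 0] by simp
    then have "\<forall>m'<Suc ?m. k \<le> card (T - sel m')"
      using * by (metis (no_types, lifting) le_nat_floor less_Suc_eq_le not_le of_nat_floor order.trans
          of_nat_le_iff add_nonneg_nonneg of_nat_0_le_iff)
    from inv[OF this] have "real (Suc ?m) \<le> K + D"
      using card_sel[of "Suc ?m"] g_le[of "Suc ?m"] by linarith
    then show False by linarith
  qed
  then obtain m0 where m0: "real m0 \<le> K + D" "card (T - sel m0) < k" by blast
  \<comment> \<open>The invariant needs at least \<open>k\<close> missing indices at all earlier
    times, so the first time with fewer is taken.\<close>
  define m where "m = (LEAST m. card (T - sel m) < k)"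
  have "card (T - sel m) < k" "m \<le> m0" "\<forall>m'<m. k \<le> card (T - sel m')"
    unfolding m_def using m0(2) by (auto intro: LeastI Least_le dest: not_less_Least)
  then show thesis using inv[of m] m0(1) that[of m] by (auto simp: w_def)
qed

text \<open>The first phase takes at most \<open>K + D\<close> iterations and leaves at most
  \<open>k - 1\<close> indices missing, which need at most \<open>128 * (k - 1)\<close> more. The
  condition \<open>D + r \<le> K\<close> keeps all supports within sparsity \<open>2 * K\<close>,
  even if every later selection is wrong.\<close>

lemma recovery:
  fixes \<eta> a D r :: real
  assumes "\<And>i. \<bar>x i\<bar> \<le> 1" and "card {i\<in>T. \<bar>x i\<bar> < a} < s"
    and "1 \<le> q" "q + s \<le> k" and "k \<le> K"
    and "\<delta> * (2 + K / q) \<le> \<eta>" "\<eta> \<le> a\<^sup>2 / 4" and "0 < a" "a \<le> 1"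
    and D: "real (q - 1) + 4 * \<eta> * K \<le> D * (a\<^sup>2 / 2)" "D + 1 \<le> K"
    and r: "real (128 * (k - 1)) \<le> r" "D + r \<le> K" and n: "K + D + r \<le> n"
  shows "energy n = 0"
proof -
  obtain m where m: "real m \<le> K + D" "card (T - sel m) < k" "card (sel m - T) \<le> D"
    using few_wrong_selections assms(1-11) by blast
  have "real (card (T \<union> sel (m + 128 * (k - 1)))) \<le> real (K + card (sel m - T) + 128 * (k - 1))"
    using card_T_union_sel_add[of m "128 * (k - 1)"] unfolding card_T_union_sel by linarith
  also have "\<dots> \<le> 2 * K" using m(3) r by simp
  finally have "card (T \<union> sel (m + 128 * (k - 1))) \<le> 2 * K" by linarith
  then have "energy (m + 128 * (k - 1)) = 0"
    using m(2) by (intro energy_zero_of_few_missing) auto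
  moreover have "m + 128 * (k - 1) \<le> n" using m(1) r n by linarith
  ultimately show ?thesis using energy_antimono form_nonneg[of "c n"] by (metis order.antisym)
qed

end

subsection \<open>Spans and orthogonal projections\<close>

lemma span_vec_closed: "W \<subseteq> carrier_vec M \<Longrightarrow> v \<in> span_vec M W \<Longrightarrow> v \<in> carrier_vec M"
proof -
  interpret vec_space "TYPE(real)" M .
  show "W \<subseteq> carrier_vec M \<Longrightarrow> v \<in> span_vec M W \<Longrightarrow> v \<in> carrier_vec M"
    unfolding span_vec_def by (rule span_closed)
qed

lemma zero_in_span_vec: "0\<^sub>v M \<in> span_vec M W"
proof -
  interpret vec_space "TYPE(real)" M .
  show ?thesis unfolding span_vec_def using span_zero by simp
qed

lemma add_in_span_vec:
  assumes "W \<subseteq> carrier_vec M" "v \<in> span_vec M W" "w \<in> span_vec M W"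
  shows "v + w \<in> span_vec M W"
proof -
  interpret vec_space "TYPE(real)" M .
  show ?thesis using assms unfolding span_vec_def by (intro span_add1)
qed

lemma smult_in_span_vec:
  assumes "W \<subseteq> carrier_vec M" "v \<in> span_vec M W"
  shows "t \<cdot>\<^sub>v v \<in> span_vec M W"
proof -
  interpret vec_space "TYPE(real)" M .
  show ?thesis using assms unfolding span_vec_def by (intro smult_in_span)
qed

lemma minus_in_span_vec:
  assumes "W \<subseteq> carrier_vec M" "v \<in> span_vec M W" "w \<in> span_vec M W"
  shows "v - w \<in> span_vec M W"
proof -
  have "v - w = v + (- 1) \<cdot>\<^sub>v w"
    using assms by (intro eq_vecI) (auto dest: span_vec_closed)
  then show ?thesis using assms by (simp add: add_in_span_vec smult_in_span_vec)
qed

lemma span_vec_superset: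
  assumes "W \<subseteq> carrier_vec M" shows "W \<subseteq> span_vec M W"
proof -
  interpret vec_space "TYPE(real)" M .
  show ?thesis using assms unfolding span_vec_def by (intro in_own_span)
qed

lemma span_vec_mono: "W \<subseteq> W' \<Longrightarrow> span_vec M W \<subseteq> span_vec M W'"
proof -
  interpret vec_space "TYPE(real)" M .
  show "W \<subseteq> W' \<Longrightarrow> span_vec M W \<subseteq> span_vec M W'"
    unfolding span_vec_def by (rule span_is_monotone)
qed

lemma span_vec_minimal:
  assumes "W \<subseteq> U" "U \<subseteq> carrier_vec M" "0\<^sub>v M \<in> U"
    and "\<And>v w. v \<in> U \<Longrightarrow> w \<in> U \<Longrightarrow> v + w \<in> U" "\<And>t v. v \<in> U \<Longrightarrow> t \<cdot>\<^sub>v v \<in> U"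
  shows "span_vec M W \<subseteq> U"
proof -
  interpret vec_space "TYPE(real)" M .
  have "submodule class_ring U V"
    using assms module_axioms by (auto simp: submodule_def)
  then show ?thesis unfolding span_vec_def using assms(1) by (intro span_is_subset)
qed

lemma scalar_prod_self_eq_0:
  fixes v :: "real vec"
  assumes "v \<in> carrier_vec M" "v \<bullet> v = 0"
  shows "v = 0\<^sub>v M"
proof (intro eq_vecI)
  fix i assume i: "i < dim_vec (0\<^sub>v M)"
  then have "(\<Sum>k<M. (v $ k)\<^sup>2) = 0"
    using assms by (simp add: scalar_prod_def power2_eq_square lessThan_atLeast0)
  then show "v $ i = 0\<^sub>v M $ i" using i by (simp add: sum_nonneg_eq_0_iff)
qed (use assms in simp)

lemma is_orth_projI:
  assumes W: "W \<subseteq> carrier_vec M" and v: "v \<in> carrier_vec M" and g: "g \<in> span_vec M W"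
    and orth: "\<And>w. w \<in> W \<Longrightarrow> (v - g) \<bullet> w = 0"
  shows "is_orth_proj (span_vec M W) v g"
proof -
  have gc: "g \<in> carrier_vec M" using span_vec_closed[OF W g] .
  have "span_vec M W \<subseteq> {h \<in> carrier_vec M. (v - g) \<bullet> h = 0}"
    using W orth v gc
    by (intro span_vec_minimal) (auto simp: scalar_prod_add_distrib[of _ M])
  then show ?thesis using g by (auto simp: is_orth_proj_def)
qed

lemma is_orth_proj_unique:
  assumes W: "W \<subseteq> carrier_vec M" and v: "v \<in> carrier_vec M"
    and g: "is_orth_proj (span_vec M W) v g" and g': "is_orth_proj (span_vec M W) v g'"
  shows "g = g'"
proof -
  have mem: "g \<in> span_vec M W" "g' \<in> span_vec M W" using g g' by (auto simp: is_orth_proj_def)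
  then have c: "g \<in> carrier_vec M" "g' \<in> carrier_vec M" using W span_vec_closed by blast+
  let ?d = "g - g'"
  have "?d \<in> span_vec M W" using W mem by (rule minus_in_span_vec)
  then have "(v - g) \<bullet> ?d = 0" "(v - g') \<bullet> ?d = 0" using g g' by (auto simp: is_orth_proj_def)
  moreover have "?d \<bullet> ?d = (v - g') \<bullet> ?d - (v - g) \<bullet> ?d"
    using c v by (simp add: minus_scalar_prod_distrib[of _ M])
  ultimately have d0: "?d = 0\<^sub>v M" using c by (intro scalar_prod_self_eq_0) auto
  have "g $ i = g' $ i" if "i < M" for i
  proof -
    have "g $ i - g' $ i = ?d $ i" using c that by simp
    also have "\<dots> = 0" unfolding d0 using that by simp
    finally show ?thesis by simp
  qed
  then show ?thesis using c by (intro eq_vecI) auto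
qed

text \<open>If \<open>a\<close> lies in the span of \<open>as\<close>, the quotient is \<open>0 / 0 = 0\<close>, as it should be.\<close>

fun gs_proj :: "nat \<Rightarrow> real vec list \<Rightarrow> real vec \<Rightarrow> real vec" where
  "gs_proj M [] v = 0\<^sub>v M"
| "gs_proj M (a # as) v =
    gs_proj M as v + ((v \<bullet> (a - gs_proj M as a)) / ((a - gs_proj M as a) \<bullet> (a - gs_proj M as a)))
      \<cdot>\<^sub>v (a - gs_proj M as a)"

text \<open>Gram-Schmidt: \<open>a'\<close> is orthogonal to the earlier span, so adding the
  projection onto its line preserves the orthogonality already achieved. The list may be linearly
  dependent.\<close>

lemma gs_proj_is_orth_proj:
  assumes "set as \<subseteq> carrier_vec M" "v \<in> carrier_vec M"
  shows "is_orth_proj (span_vec M (set as)) v (gs_proj M as v)"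
  using assms
proof (induction as arbitrary: v)
  case Nil
  then show ?case by (intro is_orth_projI) (auto simp: zero_in_span_vec)
next
  case (Cons a as)
  let ?S = "span_vec M (set as)" and ?S' = "span_vec M (set (a # as))"
  define a' where "a' = a - gs_proj M as a"
  define t where "t = (v \<bullet> a') / (a' \<bullet> a')"
  define p where "p = gs_proj M as v"
  have a: "a \<in> carrier_vec M" and as: "set as \<subseteq> carrier_vec M" and v: "v \<in> carrier_vec M"
    using Cons.prems by auto
  have pa: "gs_proj M as a \<in> ?S" and p: "p \<in> ?S"
    and orth_a: "\<And>h. h \<in> ?S \<Longrightarrow> a' \<bullet> h = 0" and orth_v: "\<And>h. h \<in> ?S \<Longrightarrow> (v - p) \<bullet> h = 0"
    using Cons.IH[OF as a] Cons.IH[OF as v] by (auto simp: is_orth_proj_def a'_def p_def)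
  note cl = span_vec_closed[OF as]
  have pac: "gs_proj M as a \<in> carrier_vec M" and pc: "p \<in> carrier_vec M"
    using cl pa p by auto
  then have a'c: "a' \<in> carrier_vec M" using a by (simp add: a'_def)
  have sub: "?S \<subseteq> ?S'" by (intro span_vec_mono) auto
  have a_in: "a \<in> ?S'" using span_vec_superset[OF Cons.prems(1)] by auto
  then have "a' \<in> ?S'" unfolding a'_def
    using pa sub Cons.prems(1) by (intro minus_in_span_vec) auto
  then have mem: "p + t \<cdot>\<^sub>v a' \<in> ?S'"
    using p sub Cons.prems(1) by (intro add_in_span_vec smult_in_span_vec) auto
  have split: "(v - (p + t \<cdot>\<^sub>v a')) \<bullet> h = (v - p) \<bullet> h - t * (a' \<bullet> h)" if "h \<in> carrier_vec M" for h
    using that v pc a'c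
    by (simp add: minus_scalar_prod_distrib[of _ M] add_scalar_prod_distrib[of _ M])
  have orth: "(v - (p + t \<cdot>\<^sub>v a')) \<bullet> h = 0" if "h \<in> ?S" for h
    using split[OF cl[OF that]] orth_a[OF that] orth_v[OF that] by simp
  have "p \<bullet> a' = 0" using orth_a[OF p] comm_scalar_prod[OF pc a'c] by simp
  then have "(v - p) \<bullet> a' = v \<bullet> a'"
    using v pc a'c by (simp add: minus_scalar_prod_distrib[of _ M])
  moreover have "t * (a' \<bullet> a') = v \<bullet> a'"
  proof (cases "a' \<bullet> a' = 0")
    case True
    then have "a' = 0\<^sub>v M" using a'c by (intro scalar_prod_self_eq_0)
    then show ?thesis using v by (simp add: t_def)
  qed (simp add: t_def)
  ultimately have "(v - (p + t \<cdot>\<^sub>v a')) \<bullet> a' = 0" using split[OF a'c] by simp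
  then have "(v - (p + t \<cdot>\<^sub>v a')) \<bullet> (a' + gs_proj M as a) = 0"
    using orth[OF pa] a'c pac v pc by (simp add: scalar_prod_add_distrib[of _ M])
  moreover have "a' + gs_proj M as a = a"
    unfolding a'_def using a pac by auto
  ultimately have "(v - (p + t \<cdot>\<^sub>v a')) \<bullet> a = 0" by simp
  moreover have "gs_proj M (a # as) v = p + t \<cdot>\<^sub>v a'"
    by (simp add: a'_def t_def p_def)
  ultimately show ?case
    using Cons.prems mem orth span_vec_superset[OF as] by (intro is_orth_projI) auto
qed

lemma eucl_norm_square: "(eucl_norm v)\<^sup>2 = v \<bullet> v"
  unfolding eucl_norm_def by (simp add: scalar_prod_def sum_nonneg)

lemma scalar_prod_self: "v \<bullet> v = (\<Sum>k<dim_vec v. (v $ k)\<^sup>2)" for v :: "real vec"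
  by (simp add: scalar_prod_def power2_eq_square lessThan_atLeast0)

subsection \<open>The isometric constant\<close>

text \<open>The Frobenius norm bound; it provides one admissible isometric constant.\<close>

lemma mult_mat_vec_square_le:
  fixes \<Phi> :: "real mat"
  assumes "\<Phi> \<in> carrier_mat M N" "x \<in> carrier_vec N"
  shows "(\<Phi> *\<^sub>v x) \<bullet> (\<Phi> *\<^sub>v x) \<le> (\<Sum>k<M. row \<Phi> k \<bullet> row \<Phi> k) * (x \<bullet> x)"
proof -
  have "(\<Phi> *\<^sub>v x) \<bullet> (\<Phi> *\<^sub>v x) = (\<Sum>k<M. (row \<Phi> k \<bullet> x)\<^sup>2)"
    using assms by (simp add: scalar_prod_self)
  also have "\<dots> \<le> (\<Sum>k<M. (row \<Phi> k \<bullet> row \<Phi> k) * (x \<bullet> x))"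
  proof (rule sum_mono)
    fix k
    show "(row \<Phi> k \<bullet> x)\<^sup>2 \<le> (row \<Phi> k \<bullet> row \<Phi> k) * (x \<bullet> x)"
      using assms Cauchy_Schwarz_ineq_sum[of "\<lambda>i. row \<Phi> k $ i" "\<lambda>i. x $ i" "{0..<N}"]
      by (simp add: scalar_prod_def power2_eq_square)
  qed
  finally show ?thesis by (simp add: sum_distrib_right)
qed

text \<open>\<open>LEAST\<close> over the reals is meaningful only if the minimum exists. The
  admissible constants are bounded below, nonempty and contain their infimum; the bounds then weaken
  from \<open>d0\<close> to \<open>\<delta>\<close>.\<close>

lemma rip_const_bound:
  assumes \<Phi>: "\<Phi> \<in> carrier_mat M N" and pos: "0 < N" "0 < S" and less: "rip_const S \<Phi> < \<delta>"
    and x: "x \<in> carrier_vec N" "sparse_vec S x"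
  shows "(1 - \<delta>) * (x \<bullet> x) \<le> (\<Phi> *\<^sub>v x) \<bullet> (\<Phi> *\<^sub>v x)" "(\<Phi> *\<^sub>v x) \<bullet> (\<Phi> *\<^sub>v x) \<le> (1 + \<delta>) * (x \<bullet> x)"
proof -
  let ?sp = "{x \<in> carrier_vec N. sparse_vec S x}"
  let ?P = "\<lambda>d. \<forall>x\<in>?sp. (1 - d) * (x \<bullet> x) \<le> (\<Phi> *\<^sub>v x) \<bullet> (\<Phi> *\<^sub>v x) \<and>
    (\<Phi> *\<^sub>v x) \<bullet> (\<Phi> *\<^sub>v x) \<le> (1 + d) * (x \<bullet> x)"
  have rip: "rip_const S \<Phi> = (LEAST d. ?P d)"
    unfolding rip_const_def eucl_norm_square using \<Phi> by (intro arg_cong[where f = Least]) auto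
  have nn: "0 \<le> v \<bullet> v" for v :: "real vec" by (simp add: scalar_prod_self sum_nonneg)
  define d0 where "d0 = Inf {d. ?P d}"
  have bdd: "bdd_below {d. ?P d}"
  proof (rule bdd_belowI[of _ 0])
    fix d assume d: "d \<in> {d. ?P d}"
    \<comment> \<open>A coordinate vector is sparse and yields
      \<open>1 - d \<le> 1 + d\<close>.\<close>
    let ?u = "unit_vec N 0 :: real vec"
    have "{i. i < N \<and> ?u $ i \<noteq> 0} = {0}" using pos by (auto simp: unit_vec_def split: if_splits)
    then have "sparse_vec S ?u" using pos by (simp add: sparse_vec_def)
    then have "(1 - d) * (?u \<bullet> ?u) \<le> (1 + d) * (?u \<bullet> ?u)" using d by force
    moreover have "?u \<bullet> ?u = 1" using pos by simp
    ultimately show "0 \<le> d" by simp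
  qed
  let ?C = "\<Sum>k<M. row \<Phi> k \<bullet> row \<Phi> k"
  have "?P (1 + ?C)"
  proof (intro ballI conjI)
    fix x assume "x \<in> ?sp"
    then have "(\<Phi> *\<^sub>v x) \<bullet> (\<Phi> *\<^sub>v x) \<le> ?C * (x \<bullet> x)" using \<Phi> by (intro mult_mat_vec_square_le) auto
    also have "\<dots> \<le> (1 + (1 + ?C)) * (x \<bullet> x)" using nn by (intro mult_right_mono) auto
    finally show "(\<Phi> *\<^sub>v x) \<bullet> (\<Phi> *\<^sub>v x) \<le> (1 + (1 + ?C)) * (x \<bullet> x)" .
    have "(1 - (1 + ?C)) * (x \<bullet> x) \<le> 0" using nn by (intro mult_nonpos_nonneg) (auto intro: sum_nonneg)
    also have "0 \<le> (\<Phi> *\<^sub>v x) \<bullet> (\<Phi> *\<^sub>v x)" by (rule nn)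
    finally show "(1 - (1 + ?C)) * (x \<bullet> x) \<le> (\<Phi> *\<^sub>v x) \<bullet> (\<Phi> *\<^sub>v x)" .
  qed
  then have ne: "{d. ?P d} \<noteq> {}" by blast
  \<comment> \<open>For nonzero \<open>x\<close> the two conditions are lower bounds on
    \<open>d\<close>, and these pass to the infimum.\<close>
  have "?P d0"
  proof
    fix x assume x: "x \<in> ?sp"
    let ?n = "x \<bullet> x" and ?y = "(\<Phi> *\<^sub>v x) \<bullet> (\<Phi> *\<^sub>v x)"
    show "(1 - d0) * ?n \<le> ?y \<and> ?y \<le> (1 + d0) * ?n"
    proof (cases "?n = 0")
      case True
      obtain d where "?P d" using ne by blast
      then show ?thesis using x True by force
    next
      case False
      then have n: "?n > 0" using nn[of x] by linarith
      have "max ((?n - ?y) / ?n) ((?y - ?n) / ?n) \<le> d" if "?P d" for d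
      proof -
        have "(1 - d) * ?n \<le> ?y" "?y \<le> (1 + d) * ?n" using that x by blast+
        then show ?thesis using n by (simp add: field_simps)
      qed
      then have "max ((?n - ?y) / ?n) ((?y - ?n) / ?n) \<le> d0"
        unfolding d0_def using ne by (intro cInf_greatest) auto
      then show ?thesis using n by (simp add: field_simps)
    qed
  qed
  moreover have "d0 \<le> d" if "?P d" for d
    unfolding d0_def using bdd that by (intro cInf_lower) auto
  ultimately have "rip_const S \<Phi> = d0" unfolding rip by (rule Least_equality)
  then have "d0 \<le> \<delta>" using less by simp
  have "(1 - \<delta>) * (x \<bullet> x) \<le> (1 - d0) * (x \<bullet> x)" "(1 + d0) * (x \<bullet> x) \<le> (1 + \<delta>) * (x \<bullet> x)"
    using \<open>d0 \<le> \<delta>\<close> nn[of x] by (auto intro: mult_right_mono)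
  then show "(1 - \<delta>) * (x \<bullet> x) \<le> (\<Phi> *\<^sub>v x) \<bullet> (\<Phi> *\<^sub>v x)" "(\<Phi> *\<^sub>v x) \<bullet> (\<Phi> *\<^sub>v x) \<le> (1 + \<delta>) * (x \<bullet> x)"
    using \<open>?P d0\<close> x by force+
qed

subsection \<open>From runs to the Gram matrix\<close>

definition comb :: "real mat \<Rightarrow> (nat \<Rightarrow> real) \<Rightarrow> real vec" where
  "comb \<Phi> d = \<Phi> *\<^sub>v vec (dim_col \<Phi>) d"

lemma comb_carrier [simp]: "\<Phi> \<in> carrier_mat M N \<Longrightarrow> comb \<Phi> d \<in> carrier_vec M"
  by (simp add: comb_def)

lemma comb_index:
  assumes "\<Phi> \<in> carrier_mat M N" "k < M"
  shows "comb \<Phi> d $ k = (\<Sum>i<N. d i * \<Phi> $$ (k, i))"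
  using assms by (auto simp: comb_def scalar_prod_def lessThan_atLeast0 mult.commute intro: sum.cong)

lemma comb_scalar_prod:
  assumes "\<Phi> \<in> carrier_mat M N" "v \<in> carrier_vec M"
  shows "comb \<Phi> d \<bullet> v = (\<Sum>i<N. d i * (col \<Phi> i \<bullet> v))"
proof -
  have "comb \<Phi> d \<bullet> v = (\<Sum>k<M. (\<Sum>i<N. d i * \<Phi> $$ (k, i)) * v $ k)"
    using assms by (simp add: scalar_prod_def lessThan_atLeast0[symmetric] comb_index[OF assms(1)])
  also have "\<dots> = (\<Sum>i<N. \<Sum>k<M. d i * (\<Phi> $$ (k, i) * v $ k))"
    unfolding sum_distrib_right by (subst sum.swap) (simp add: mult_ac)
  also have "\<dots> = (\<Sum>i<N. d i * (col \<Phi> i \<bullet> v))"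
    using assms by (simp add: scalar_prod_def lessThan_atLeast0[symmetric] sum_distrib_left)
  finally show ?thesis .
qed

lemma synth_index:
  assumes "\<Phi> \<in> carrier_mat M N" "T \<subseteq> {..<N}" "k < M"
  shows "synth \<Phi> T x $ k = (\<Sum>i\<in>T. x i * \<Phi> $$ (k, i))"
proof -
  have "finite T" using assms finite_subset by blast
  then have "synth \<Phi> T x $ k = (\<Sum>i\<in>T. (x i \<cdot>\<^sub>v col \<Phi> i) $ k)"
    unfolding synth_def using assms by (subst index_finsum_vec) (auto intro: carrier_vecI)
  also have "\<dots> = (\<Sum>i\<in>T. x i * \<Phi> $$ (k, i))"
    using assms by (intro sum.cong refl) auto
  finally show ?thesis .
qed

lemma synth_carrier: "\<Phi> \<in> carrier_mat M N \<Longrightarrow> synth \<Phi> T x \<in> carrier_vec M"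
  unfolding synth_def by (auto simp: finsum_vec_closed Pi_def intro: carrier_vecI)

lemma synth_eq_comb:
  assumes "\<Phi> \<in> carrier_mat M N" "T \<subseteq> {..<N}"
  shows "synth \<Phi> T x = comb \<Phi> (\<lambda>i. if i \<in> T then x i else 0)"
proof (rule eq_vecI)
  fix k assume "k < dim_vec (comb \<Phi> (\<lambda>i. if i \<in> T then x i else 0))"
  then have k: "k < M" using assms by (simp add: comb_def)
  show "synth \<Phi> T x $ k = comb \<Phi> (\<lambda>i. if i \<in> T then x i else 0) $ k"
    unfolding synth_index[OF assms k] comb_index[OF assms(1) k]
    using assms(2) by (intro sum.mono_neutral_cong_left) auto
qed (use assms synth_carrier[OF assms(1), of T x] in \<open>simp add: comb_def\<close>)

text \<open>The combinations supported on \<open>I\<close> form a subspace containing the columns,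
  so they contain the span. Coefficients belong to indices, so coinciding columns do no
  harm.\<close>

lemma in_span_cols_comb:
  assumes \<Phi>: "\<Phi> \<in> carrier_mat M N" and "I \<subseteq> {..<N}" and "g \<in> span_vec M (col \<Phi> ` I)"
  obtains d where "\<And>i. i \<notin> I \<Longrightarrow> d i = 0" "g = comb \<Phi> d"
proof -
  let ?U = "{comb \<Phi> d |d. \<forall>i. i \<notin> I \<longrightarrow> d i = 0}"
  have "span_vec M (col \<Phi> ` I) \<subseteq> ?U"
  proof (rule span_vec_minimal)
    show "col \<Phi> ` I \<subseteq> ?U"
    proof
      fix v assume "v \<in> col \<Phi> ` I"
      then obtain j where j: "j \<in> I" "v = col \<Phi> j" by auto
      then have "v = comb \<Phi> (\<lambda>i. if i = j then 1 else 0)"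
      proof (intro eq_vecI)
        fix k assume "k < dim_vec (comb \<Phi> (\<lambda>i. if i = j then 1 else 0))"
        then have k: "k < M" using \<Phi> by (simp add: comb_def)
        have "(\<Sum>i<N. (if i = j then 1 else 0) * \<Phi> $$ (k, i)) = (\<Sum>i<N. if i = j then \<Phi> $$ (k, i) else 0)"
          by (intro sum.cong) auto
        also have "\<dots> = \<Phi> $$ (k, j)" using j(1) \<open>I \<subseteq> {..<N}\<close> by (auto simp: sum.delta)
        finally show "v $ k = comb \<Phi> (\<lambda>i. if i = j then 1 else 0) $ k"
          using k j \<Phi> \<open>I \<subseteq> {..<N}\<close> by (auto simp: comb_index[OF \<Phi> k])
      qed (use j \<Phi> in \<open>simp add: comb_def\<close>)
      then show "v \<in> ?U" using j by auto
    qed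
    show "?U \<subseteq> carrier_vec M" using \<Phi> by auto
    have "0\<^sub>v M = comb \<Phi> (\<lambda>_. 0)"
      using \<Phi> by (intro eq_vecI) (auto simp: comb_index[OF \<Phi>] carrier_vecD[OF comb_carrier[OF \<Phi>]])
    then show "0\<^sub>v M \<in> ?U" by auto
    show "v + w \<in> ?U" if vw: "v \<in> ?U" "w \<in> ?U" for v w
    proof -
      obtain d e where "v = comb \<Phi> d" "w = comb \<Phi> e" "\<forall>i. i \<notin> I \<longrightarrow> d i = 0" "\<forall>i. i \<notin> I \<longrightarrow> e i = 0"
        using vw by auto
      moreover have "comb \<Phi> d + comb \<Phi> e = comb \<Phi> (\<lambda>i. d i + e i)"
        using \<Phi> by (intro eq_vecI)
          (auto simp: comb_index[OF \<Phi>] carrier_vecD[OF comb_carrier[OF \<Phi>]] algebra_simps sum.distrib)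
      ultimately show ?thesis by (intro CollectI exI[of _ "\<lambda>i. d i + e i"]) auto
    qed
    show "t \<cdot>\<^sub>v v \<in> ?U" if v: "v \<in> ?U" for t v
    proof -
      obtain d where "v = comb \<Phi> d" "\<forall>i. i \<notin> I \<longrightarrow> d i = 0"
        using v by auto
      moreover have "t \<cdot>\<^sub>v comb \<Phi> d = comb \<Phi> (\<lambda>i. t * d i)"
        using \<Phi> by (intro eq_vecI)
          (auto simp: comb_index[OF \<Phi>] carrier_vecD[OF comb_carrier[OF \<Phi>]] mult.assoc sum_distrib_left)
      ultimately show ?thesis by (intro CollectI exI[of _ "\<lambda>i. t * d i"]) auto
    qed
  qed
  then show thesis using assms(3) that by blast
qed

lemma gram_corr_eq:
  assumes "\<Phi> \<in> carrier_mat M N" "j < N"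
  shows "gram_corr (\<lambda>i j. col \<Phi> i \<bullet> col \<Phi> j) N d j = comb \<Phi> d \<bullet> col \<Phi> j"
  using assms by (simp add: gram_corr_def comb_scalar_prod[OF assms(1)] carrier_vecI)

lemma gram_form_eq:
  assumes "\<Phi> \<in> carrier_mat M N"
  shows "gram_form (\<lambda>i j. col \<Phi> i \<bullet> col \<Phi> j) N d e = comb \<Phi> d \<bullet> comb \<Phi> e"
proof -
  have "gram_form (\<lambda>i j. col \<Phi> i \<bullet> col \<Phi> j) N d e = (\<Sum>j<N. e j * (comb \<Phi> d \<bullet> col \<Phi> j))"
    unfolding gram_form_def by (intro sum.cong refl) (simp add: gram_corr_eq[OF assms])
  also have "\<dots> = (\<Sum>j<N. e j * (col \<Phi> j \<bullet> comb \<Phi> d))"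
    using assms by (intro sum.cong refl arg_cong2[where f = "(*)"] comm_scalar_prod[of _ M])
      (auto intro: carrier_vecI)
  also have "\<dots> = comb \<Phi> e \<bullet> comb \<Phi> d"
    using assms by (simp add: comb_scalar_prod[OF assms])
  also have "\<dots> = comb \<Phi> d \<bullet> comb \<Phi> e"
    using assms by (intro comm_scalar_prod[of _ M]) auto
  finally show ?thesis .
qed

lemma set_cols: "\<Phi> \<in> carrier_mat M N \<Longrightarrow> set (cols \<Phi>) = col \<Phi> ` {..<N}"
  by (auto simp: cols_def)

text \<open>This lifts a run from vectors to coefficients: an index is chosen for each selected
  column and coordinates for each projection.\<close>

lemma omp_run_gram:
  assumes dict: "dictionary M N \<Phi>" and T: "T \<subseteq> {..<N}" "card T = K" and K: "0 < K"
    and rip: "rip_const (2 * K) \<Phi> < \<delta>" and \<delta>: "0 \<le> \<delta>" "\<delta> \<le> 1 / 4"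
    and run: "omp_run \<Phi> (synth \<Phi> T x) \<phi> f"
  obtains idx c where
    "gram_omp (\<lambda>i j. col \<Phi> i \<bullet> col \<Phi> j) N K \<delta> T (\<lambda>i. if i \<in> T then x i else 0) idx c"
    "\<And>m. f m = comb \<Phi> (c m)"
proof -
  let ?x = "\<lambda>i. if i \<in> T then x i else 0"
  let ?G = "\<lambda>i j. col \<Phi> i \<bullet> col \<Phi> j"
  have \<Phi>: "\<Phi> \<in> carrier_mat M N" and "M < N" and unit: "\<And>i. i < N \<Longrightarrow> eucl_norm (col \<Phi> i) = 1"
    using dict by (auto simp: dictionary_def)
  have rows: "dim_row \<Phi> = M" using \<Phi> by simp
  have colc: "col \<Phi> i \<in> carrier_vec M" for i using \<Phi> by (simp add: carrier_vecI)
  have "\<exists>i<N. \<phi> m = col \<Phi> i" if "m \<ge> 1" for m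
    using run that unfolding omp_run_def set_cols[OF \<Phi>] by blast
  then obtain idx where idx: "\<And>m. m \<ge> 1 \<Longrightarrow> idx m < N \<and> \<phi> m = col \<Phi> (idx m)"
    by metis
  have "\<exists>d. (\<forall>i. i \<notin> idx ` {Suc 0..m} \<longrightarrow> d i = ?x i) \<and> f m = comb \<Phi> d \<and>
      (\<forall>i\<in>idx ` {Suc 0..m}. f m \<bullet> col \<Phi> i = 0)" for m
  proof (cases "m = 0")
    case True
    then show ?thesis
      using run by (intro exI[of _ ?x]) (auto simp: omp_run_def synth_eq_comb[OF \<Phi> T(1)])
  next
    case False
    let ?I = "idx ` {Suc 0..m}"
    have im: "\<phi> ` {1..m} = col \<Phi> ` ?I" using idx by (force simp: image_image)
    have I: "?I \<subseteq> {..<N}" using idx by auto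
    have "1 \<le> m" using False by simp
    then have "\<exists>g. is_orth_proj (span_vec (dim_row \<Phi>) (\<phi> ` {1..m})) (synth \<Phi> T x) g \<and>
        f m = synth \<Phi> T x - g"
      using run unfolding omp_run_def by blast
    then obtain g where g: "is_orth_proj (span_vec M (col \<Phi> ` ?I)) (synth \<Phi> T x) g" "f m = synth \<Phi> T x - g"
      unfolding rows im by blast
    then have "g \<in> span_vec M (col \<Phi> ` ?I)" by (simp add: is_orth_proj_def)
    then obtain d where d: "\<And>i. i \<notin> ?I \<Longrightarrow> d i = 0" "g = comb \<Phi> d"
      using in_span_cols_comb[OF \<Phi> I] by metis
    \<comment> \<open>Subtracting the projection changes coefficients at selected indices only, as
      \<open>coeff_kept\<close> requires.\<close>
    have "comb \<Phi> ?x - comb \<Phi> d = comb \<Phi> (\<lambda>i. ?x i - d i)"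
      using \<Phi> by (intro eq_vecI)
        (auto simp: comb_index[OF \<Phi>] carrier_vecD[OF comb_carrier[OF \<Phi>]] left_diff_distrib sum_subtractf)
    then have "f m = comb \<Phi> (\<lambda>i. ?x i - d i)"
      unfolding g(2) d(2) synth_eq_comb[OF \<Phi> T(1)] .
    moreover have "f m \<bullet> col \<Phi> i = 0" if "i \<in> ?I" for i
    proof -
      have "col \<Phi> i \<in> span_vec M (col \<Phi> ` ?I)"
        using that colc span_vec_superset[of "col \<Phi> ` ?I" M] by blast
      then show ?thesis using g by (simp add: is_orth_proj_def)
    qed
    ultimately show ?thesis using d(1) by (intro exI[of _ "\<lambda>i. ?x i - d i"]) auto
  qed
  then obtain c where c: "\<And>m i. i \<notin> idx ` {Suc 0..m} \<Longrightarrow> c m i = ?x i" "\<And>m. f m = comb \<Phi> (c m)"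
      "\<And>m i. i \<in> idx ` {Suc 0..m} \<Longrightarrow> f m \<bullet> col \<Phi> i = 0"
    by metis
  have "gram_omp ?G N K \<delta> T ?x idx c"
  proof
    show "?G i j = ?G j i" for i j using colc by (rule comm_scalar_prod[OF _ colc])
    show "?G i i = 1" if "i < N" for i using unit[OF that] eucl_norm_square[of "col \<Phi> i"] by simp
    show "gram_form ?G N d d \<ge> 0" for d
      unfolding gram_form_eq[OF \<Phi>] by (simp add: scalar_prod_self sum_nonneg)
    show "(1 - \<delta>) * (\<Sum>i<N. (d i)\<^sup>2) \<le> gram_form ?G N d d \<and>
        gram_form ?G N d d \<le> (1 + \<delta>) * (\<Sum>i<N. (d i)\<^sup>2)"
      if "card {i. i < N \<and> d i \<noteq> 0} \<le> 2 * K" for d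
    proof -
      have "{i. i < N \<and> vec N d $ i \<noteq> 0} = {i. i < N \<and> d i \<noteq> 0}" by auto
      then have "sparse_vec (2 * K) (vec N d)" using that by (simp add: sparse_vec_def)
      moreover have "vec N d \<bullet> vec N d = (\<Sum>i<N. (d i)\<^sup>2)"
        by (simp add: scalar_prod_self)
      moreover have "comb \<Phi> d = \<Phi> *\<^sub>v vec N d" using \<Phi> by (simp add: comb_def)
      ultimately show ?thesis
        unfolding gram_form_eq[OF \<Phi>] using rip_const_bound[OF \<Phi> _ _ rip, of "vec N d"] K \<open>M < N\<close>
        by simp
    qed
    show "0 \<le> \<delta>" "\<delta> \<le> 1 / 4" "T \<subseteq> {..<N}" "card T = K" by fact+
    show "idx m < N" if "1 \<le> m" for m using idx[OF that] by simp
    show "c m i = ?x i" if "i \<notin> idx ` {Suc 0..m}" for m i using c(1)[OF that] .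
    show "gram_corr ?G N (c m) i = 0" if "i \<in> idx ` {Suc 0..m}" for m i
    proof -
      have "i < N" using that idx by auto
      then show ?thesis unfolding gram_corr_eq[OF \<Phi> \<open>i < N\<close>] c(2)[symmetric] using c(3) that by blast
    qed
    show "\<bar>gram_corr ?G N (c m) j\<bar> \<le> \<bar>gram_corr ?G N (c m) (idx (Suc m))\<bar>" if "j < N" for m j
    proof -
      have i: "idx (Suc m) < N" "\<phi> (Suc m) = col \<Phi> (idx (Suc m))" using idx[of "Suc m"] by auto
      have "\<bar>f m \<bullet> col \<Phi> j\<bar> \<le> (SUP g\<in>set (cols \<Phi>). \<bar>f m \<bullet> g\<bar>)"
        using that by (intro cSUP_upper bdd_above_finite finite_imageI) (auto simp: set_cols[OF \<Phi>])
      also have "\<dots> = \<bar>f m \<bullet> \<phi> (Suc m)\<bar>"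
        using run unfolding omp_run_def by (metis diff_Suc_1 le_add1 plus_1_eq_Suc)
      finally show ?thesis
        unfolding gram_corr_eq[OF \<Phi> that] gram_corr_eq[OF \<Phi> i(1)] c(2)[symmetric] i(2) .
    qed
  qed simp
  then show thesis using that c(2) by blast
qed

subsection \<open>Measurability of the recovery event\<close>

definition residual :: "nat \<Rightarrow> real vec list \<Rightarrow> real vec \<Rightarrow> real vec" where
  "residual M as v = v - gs_proj M as v"

text \<open>List positions start at 0: \<open>as ! m\<close> is the choice of iteration
  \<open>m + 1\<close>, made from the residual after \<open>take m as\<close>.\<close>

definition greedy_list :: "nat \<Rightarrow> real vec set \<Rightarrow> real vec \<Rightarrow> real vec list \<Rightarrow> bool" where
  "greedy_list M D v as \<longleftrightarrow> (\<forall>m<length as. as ! m \<in> D \<and>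
     (\<forall>g\<in>D. \<bar>residual M (take m as) v \<bullet> g\<bar> \<le> \<bar>residual M (take m as) v \<bullet> (as ! m)\<bar>))"

lemma gs_proj_carrier:
  "set as \<subseteq> carrier_vec M \<Longrightarrow> v \<in> carrier_vec M \<Longrightarrow> gs_proj M as v \<in> carrier_vec M"
  using gs_proj_is_orth_proj span_vec_closed by (auto simp: is_orth_proj_def)

lemma residual_carrier:
  "set as \<subseteq> carrier_vec M \<Longrightarrow> v \<in> carrier_vec M \<Longrightarrow> residual M as v \<in> carrier_vec M"
  by (simp add: residual_def gs_proj_carrier)

lemma greedy_list_extend:
  assumes D: "finite D" "D \<noteq> {}" and as: "greedy_list M D v as"
  obtains a where "greedy_list M D v (as @ [a])"
proof -
  let ?h = "\<lambda>g. \<bar>residual M as v \<bullet> g\<bar>"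
  have "Max (?h ` D) \<in> ?h ` D" using D by (intro Max_in) auto
  then obtain a where a: "a \<in> D" "Max (?h ` D) = ?h a" by auto
  have "?h g \<le> ?h a" if "g \<in> D" for g
    unfolding a(2)[symmetric] using D that by (intro Max_ge) auto
  then have "greedy_list M D v (as @ [a])"
    using as a(1) by (auto simp: greedy_list_def nth_append less_Suc_eq)
  then show thesis by (rule that)
qed

text \<open>Greedy choices are appended one at a time; the lists \<open>E j\<close> extend each
  other, so their entries stabilize to a sequence \<open>\<psi>\<close>.\<close>

lemma greedy_list_infinite_extension:
  assumes D: "finite D" "D \<noteq> {}" and as: "greedy_list M D v as"
  obtains \<psi> where "map \<psi> [0..<length as] = as" "\<And>m. greedy_list M D v (map \<psi> [0..<m])"
proof -
  define next_elem where "next_elem L = (SOME a. greedy_list M D v (L @ [a]))" for L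
  define E where "E j = ((\<lambda>L. L @ [next_elem L]) ^^ j) as" for j
  have E_0: "E 0 = as" and E_Suc: "E (Suc j) = E j @ [next_elem (E j)]" for j
    by (simp_all add: E_def)
  have len: "length (E j) = length as + j" for j
    by (induction j) (simp_all add: E_0 E_Suc)
  have greedy: "greedy_list M D v (E j)" for j
  proof (induction j)
    case (Suc j)
    then show ?case
      unfolding E_Suc next_elem_def using greedy_list_extend[OF D Suc] by (metis someI_ex)
  qed (simp add: E_0 as)
  have prefix: "E (i + j) ! k = E i ! k" if "k < length as + i" for i j k
    using that by (induction j) (simp_all add: E_Suc nth_append len)
  define \<psi> where "\<psi> k = E (Suc k) ! k" for k
  have \<psi>: "E j ! k = \<psi> k" if "k < length as + j" for j k
  proof (cases "j \<le> Suc k")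
    case True
    then show ?thesis using prefix[OF that, of "Suc k - j"] by (simp add: \<psi>_def)
  next
    case False
    then show ?thesis using prefix[of k "Suc k" "j - Suc k"] by (simp add: \<psi>_def)
  qed
  have take: "take m (E j) = map \<psi> [0..<m]" if "m \<le> length as + j" for m j
    using that by (intro nth_equalityI) (auto simp: len \<psi>)
  have "map \<psi> [0..<length as] = as" using take[of "length as" 0] by (simp add: E_0)
  moreover have "greedy_list M D v (map \<psi> [0..<m])" for m
  proof -
    have "greedy_list M D v (take m (E m))"
      using greedy[of m] by (auto simp: greedy_list_def min_def)
    then show ?thesis using take[of m m] by simp
  qed
  ultimately show thesis by (rule that)
qed

lemma SUP_eq_attained:
  fixes h :: "'a \<Rightarrow> real"
  assumes "a \<in> D" "\<And>g. g \<in> D \<Longrightarrow> h g \<le> h a"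
  shows "(SUP g\<in>D. h g) = h a"
  using assms by (intro cSup_eq_maximum) auto

text \<open>
  The right-hand side is a finite union of events, which makes the recovery event measurable. For
  the converse a finite greedy selection has to be extended to an infinite run.
\<close>

lemma omp_run_iff_greedy_list:
  assumes \<Phi>: "\<Phi> \<in> carrier_mat M N" "0 < N" and v: "v \<in> carrier_vec M"
  shows "(\<exists>\<phi> f. omp_run \<Phi> v \<phi> f \<and> f n \<noteq> 0\<^sub>v M) \<longleftrightarrow>
    (\<exists>as\<in>{as. set as \<subseteq> set (cols \<Phi>) \<and> length as = n}.
      greedy_list M (set (cols \<Phi>)) v as \<and> residual M as v \<noteq> 0\<^sub>v M)"
    (is "?L \<longleftrightarrow> ?R")
proof
  let ?D = "set (cols \<Phi>)"
  have D: "?D \<subseteq> carrier_vec M" "finite ?D" "?D \<noteq> {}"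
    using \<Phi> cols_dim[of \<Phi>] by (auto simp: set_cols[OF \<Phi>(1)] intro: carrier_vecI)
  have rows: "dim_row \<Phi> = M" using \<Phi> by simp
  have res_0: "residual M [] v = v" using v by (auto simp: residual_def)
  {
    assume ?L
    then obtain \<phi> f where run: "omp_run \<Phi> v \<phi> f" and nz: "f n \<noteq> 0\<^sub>v M" by blast
    define as where "as m = map \<phi> [1..<Suc m]" for m
    have in_D: "\<phi> m \<in> ?D" if "1 \<le> m" for m using run that by (auto simp: omp_run_def)
    have set_as: "set (as m) = \<phi> ` {1..m}" for m by (auto simp: as_def)
    have sub: "set (as m) \<subseteq> ?D" for m using in_D by (auto simp: set_as)
    have f_eq: "f m = residual M (as m) v" for m
    proof (cases "m = 0")
      case True
      then show ?thesis using run by (simp add: as_def res_0 omp_run_def)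
    next
      case False
      then have "1 \<le> m" by simp
      then obtain g where g: "is_orth_proj (span_vec M (set (as m))) v g" "f m = v - g"
        using run unfolding omp_run_def rows set_as by blast
      have W: "set (as m) \<subseteq> carrier_vec M" using sub D(1) by blast
      \<comment> \<open>By uniqueness of projections the residual depends on the run only through
        its selections.\<close>
      have "g = gs_proj M (as m) v"
        using is_orth_proj_unique[OF W v g(1) gs_proj_is_orth_proj[OF W v]] .
      then show ?thesis using g(2) by (simp add: residual_def)
    qed
    have "greedy_list M ?D v (as n)"
      unfolding greedy_list_def
    proof (intro allI impI conjI ballI)
      fix m assume "m < length (as n)"
      then have m: "m < n" by (simp add: as_def del: upt_Suc)
      have nth: "as n ! m = \<phi> (Suc m)" and take: "take m (as n) = as m"
        using m by (simp_all add: as_def take_map del: upt_Suc)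
      show "as n ! m \<in> ?D" unfolding nth by (rule in_D) simp
      fix g assume "g \<in> ?D"
      then have "\<bar>f m \<bullet> g\<bar> \<le> (SUP g\<in>?D. \<bar>f m \<bullet> g\<bar>)"
        by (intro cSUP_upper bdd_above_finite) auto
      also have "\<dots> = \<bar>f m \<bullet> \<phi> (Suc m)\<bar>"
        using run unfolding omp_run_def by (metis diff_Suc_1 le_add1 plus_1_eq_Suc)
      finally show "\<bar>residual M (take m (as n)) v \<bullet> g\<bar> \<le> \<bar>residual M (take m (as n)) v \<bullet> (as n ! m)\<bar>"
        unfolding nth take f_eq .
    qed
    then show ?R using nz sub[of n] unfolding f_eq by (intro bexI[of _ "as n"]) (auto simp: as_def)
  }
  assume ?R
  then obtain as where as: "length as = n" "greedy_list M ?D v as" "residual M as v \<noteq> 0\<^sub>v M" by auto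
  obtain \<psi> where \<psi>: "map \<psi> [0..<length as] = as" "\<And>m. greedy_list M ?D v (map \<psi> [0..<m])"
    using greedy_list_infinite_extension[OF D(2,3) as(2)] by blast
  \<comment> \<open>Runs number their selections from 1, lists from 0.\<close>
  define \<phi> where "\<phi> m = \<psi> (m - 1)" for m
  define f where "f m = residual M (map \<psi> [0..<m]) v" for m
  have greedy: "\<psi> m \<in> ?D" "\<And>g. g \<in> ?D \<Longrightarrow> \<bar>f m \<bullet> g\<bar> \<le> \<bar>f m \<bullet> \<psi> m\<bar>" for m
    using \<psi>(2)[of "Suc m"] unfolding greedy_list_def f_def
    by (auto simp: nth_append take_map dest!: spec[of _ m] simp del: upt_Suc)
  have "omp_run \<Phi> v \<phi> f"
    unfolding omp_run_def
  proof (intro conjI allI impI)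
    show "f 0 = v" by (simp add: f_def res_0)
    fix m :: nat assume m: "1 \<le> m"
    show "\<phi> m \<in> ?D" unfolding \<phi>_def by (rule greedy)
    show "\<bar>f (m - 1) \<bullet> \<phi> m\<bar> = (SUP g\<in>?D. \<bar>f (m - 1) \<bullet> g\<bar>)"
      unfolding \<phi>_def by (rule SUP_eq_attained[symmetric]) (use greedy in auto)
    have "\<phi> ` {1..m} = \<psi> ` {0..<m}"
      unfolding \<phi>_def by (force simp: image_iff intro: bexI[of _ "Suc _"])
    then have eq: "\<phi> ` {1..m} = set (map \<psi> [0..<m])" by simp
    have "set (map \<psi> [0..<m]) \<subseteq> carrier_vec M" using greedy(1) D(1) by auto
    then show "\<exists>G. is_orth_proj (span_vec (dim_row \<Phi>) (\<phi> ` {1..m})) v G \<and> f m = v - G"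
      unfolding rows eq f_def residual_def using gs_proj_is_orth_proj v by blast
  qed
  moreover have "f n \<noteq> 0\<^sub>v M" using as \<psi>(1) by (simp add: f_def)
  ultimately show ?L by blast
qed

text \<open>For a fixed list the projection is linear in the projected vector; the denominators are
  constants.\<close>

lemma measurable_gs_proj:
  fixes V :: "'a \<Rightarrow> real vec"
  assumes "\<And>k. k < M \<Longrightarrow> (\<lambda>x. V x $ k) \<in> borel_measurable \<mu>" and V: "\<And>x. V x \<in> carrier_vec M"
    and "set as \<subseteq> carrier_vec M" "k < M"
  shows "(\<lambda>x. gs_proj M as (V x) $ k) \<in> borel_measurable \<mu>"
  using assms(3,4)
proof (induction as arbitrary: k)
  case (Cons a as)
  define b where "b = a - gs_proj M as a"
  have b: "b \<in> carrier_vec M"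
    unfolding b_def using Cons.prems by (intro minus_carrier_vec gs_proj_carrier) auto
  have "gs_proj M (a # as) (V x) $ k
      = gs_proj M as (V x) $ k + ((\<Sum>i<M. V x $ i * b $ i) / (b \<bullet> b)) * b $ k" for x
  proof -
    have "gs_proj M (a # as) (V x) = gs_proj M as (V x) + ((V x \<bullet> b) / (b \<bullet> b)) \<cdot>\<^sub>v b"
      by (simp add: b_def)
    then show ?thesis
      using b Cons.prems V[of x] gs_proj_carrier[of as M "V x"]
      by (simp add: scalar_prod_def[of "V x" b] lessThan_atLeast0 del: gs_proj.simps)
  qed
  then show ?case
    using Cons assms(1) by (simp del: gs_proj.simps) measurable
qed simp

lemma measurable_residual:
  fixes V :: "'a \<Rightarrow> real vec"
  assumes "\<And>k. k < M \<Longrightarrow> (\<lambda>x. V x $ k) \<in> borel_measurable \<mu>" and V: "\<And>x. V x \<in> carrier_vec M"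
    and as: "set as \<subseteq> carrier_vec M" and k: "k < M"
  shows "(\<lambda>x. residual M as (V x) $ k) \<in> borel_measurable \<mu>"
proof -
  have "residual M as (V x) $ k = V x $ k - gs_proj M as (V x) $ k" for x
    using k V[of x] gs_proj_carrier[OF as V[of x]] by (simp add: residual_def)
  then show ?thesis using assms measurable_gs_proj[OF assms] by simp
qed

lemma measurable_failure_event:
  fixes V :: "'a \<Rightarrow> real vec"
  assumes V: "\<And>k. k < M \<Longrightarrow> (\<lambda>x. V x $ k) \<in> borel_measurable \<mu>" "\<And>x. V x \<in> carrier_vec M"
    and D: "finite D" "D \<subseteq> carrier_vec M" and as: "set as \<subseteq> D"
  shows "{x \<in> space \<mu>. greedy_list M D (V x) as \<and> residual M as (V x) \<noteq> 0\<^sub>v M} \<in> sets \<mu>"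
proof -
  have res: "residual M bs (V x) \<in> carrier_vec M" if "set bs \<subseteq> D" for bs x
    using that D V by (intro residual_carrier) auto
  have corr: "(\<lambda>x. residual M bs (V x) \<bullet> g) \<in> borel_measurable \<mu>"
    if "set bs \<subseteq> D" "g \<in> D" for bs g
  proof -
    have "residual M bs (V x) \<bullet> g = (\<Sum>k<M. residual M bs (V x) $ k * g $ k)" for x
      using res[OF that(1), of x] that(2) D by (auto simp: scalar_prod_def lessThan_atLeast0)
    moreover have "(\<lambda>x. residual M bs (V x) $ k) \<in> borel_measurable \<mu>" if "k < M" for k
      using \<open>set bs \<subseteq> D\<close> D that by (intro measurable_residual V) auto
    ultimately show ?thesis by simp
  qed
  have tk: "set (take m as) \<subseteq> D" for m using as set_take_subset by fastforce
  have "{x \<in> space \<mu>. greedy_list M D (V x) as} = {x \<in> space \<mu>. \<forall>m\<in>{..<length as}. \<forall>g\<in>D.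
      \<bar>residual M (take m as) (V x) \<bullet> g\<bar> \<le> \<bar>residual M (take m as) (V x) \<bullet> (as ! m)\<bar>}"
    using as by (auto simp: greedy_list_def)
  also have "\<dots> \<in> sets \<mu>"
  proof (intro sets.sets_Collect_finite_All D(1) finite_lessThan)
    fix m g assume "m \<in> {..<length as}" "g \<in> D"
    then have "(\<lambda>x. residual M (take m as) (V x) \<bullet> g) \<in> borel_measurable \<mu>"
      "(\<lambda>x. residual M (take m as) (V x) \<bullet> (as ! m)) \<in> borel_measurable \<mu>"
      using as tk by (auto intro!: corr)
    then show "{x \<in> space \<mu>. \<bar>residual M (take m as) (V x) \<bullet> g\<bar>
        \<le> \<bar>residual M (take m as) (V x) \<bullet> (as ! m)\<bar>} \<in> sets \<mu>"
      by measurable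
  qed
  finally have 1: "{x \<in> space \<mu>. greedy_list M D (V x) as} \<in> sets \<mu>" .
  have "{x \<in> space \<mu>. residual M as (V x) = 0\<^sub>v M}
      = {x \<in> space \<mu>. \<forall>k\<in>{..<M}. residual M as (V x) $ k = 0}"
    using res[OF as] by (auto intro!: eq_vecI)
  also have "\<dots> \<in> sets \<mu>"
  proof (intro sets.sets_Collect_finite_All finite_lessThan)
    fix k assume "k \<in> {..<M}"
    then have "(\<lambda>x. residual M as (V x) $ k) \<in> borel_measurable \<mu>"
      using as D by (intro measurable_residual V) auto
    then show "{x \<in> space \<mu>. residual M as (V x) $ k = 0} \<in> sets \<mu>" by measurable
  qed
  finally have 2: "{x \<in> space \<mu>. residual M as (V x) = 0\<^sub>v M} \<in> sets \<mu>" .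
  show ?thesis using sets.sets_Collect_conj[OF sets.sets_Collect_neg[OF 2] 1] by simp
qed

lemma sets_unif_coeffs: "sets (unif_coeffs T) = sets (\<Pi>\<^sub>M i\<in>T. borel)"
  unfolding unif_coeffs_def by (intro sets_PiM_cong) auto

lemma measurable_recovery_event:
  assumes \<Phi>: "\<Phi> \<in> carrier_mat M N" "0 < N" and T: "T \<subseteq> {..<N}"
  shows "{x \<in> space (unif_coeffs T). \<forall>\<phi> f. omp_run \<Phi> (synth \<Phi> T x) \<phi> f \<longrightarrow> f n = 0\<^sub>v M}
    \<in> sets (unif_coeffs T)"
proof -
  let ?\<mu> = "unif_coeffs T" and ?D = "set (cols \<Phi>)"
  let ?A = "{as. set as \<subseteq> ?D \<and> length as = n}"
  have D: "?D \<subseteq> carrier_vec M" using \<Phi> by (auto simp: set_cols[OF \<Phi>(1)] intro: carrier_vecI)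
  have "(\<lambda>x. synth \<Phi> T x $ k) \<in> borel_measurable ?\<mu>" if "k < M" for k
  proof -
    have "(\<lambda>x. x i) \<in> borel_measurable ?\<mu>" if "i \<in> T" for i
      using that by (subst measurable_cong_sets[OF sets_unif_coeffs refl]) measurable
    then show ?thesis unfolding synth_index[OF \<Phi>(1) T that] by measurable
  qed
  then have "(\<Union>as\<in>?A. {x \<in> space ?\<mu>. greedy_list M ?D (synth \<Phi> T x) as \<and>
      residual M as (synth \<Phi> T x) \<noteq> 0\<^sub>v M}) \<in> sets ?\<mu>" (is "?U \<in> _")
    using finite_lists_length_eq[of ?D n] D synth_carrier[OF \<Phi>(1)]
    by (intro sets.finite_UN measurable_failure_event) auto
  moreover have "{x \<in> space ?\<mu>. \<forall>\<phi> f. omp_run \<Phi> (synth \<Phi> T x) \<phi> f \<longrightarrow> f n = 0\<^sub>v M} = space ?\<mu> - ?U"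
    using omp_run_iff_greedy_list[OF \<Phi> synth_carrier[OF \<Phi>(1)], of T _ n] by blast
  ultimately show ?thesis by simp
qed

subsection \<open>Recovery with high probability\<close>

lemma prob_space_unif: "prob_space (uniform_measure lborel {-1..1::real})"
  by (intro prob_space_uniform_measure) auto

text \<open>The event is a product set with factor \<open>UNIV\<close> outside \<open>S\<close>, so
  its measure is a product over \<open>T\<close>.\<close>

lemma measure_unif_coeffs_box:
  assumes T: "finite T" and S: "S \<subseteq> T" and B: "B \<in> sets borel"
  shows "{x \<in> space (unif_coeffs T). \<forall>i\<in>S. x i \<in> B} \<in> sets (unif_coeffs T)"
    and "measure (unif_coeffs T) {x \<in> space (unif_coeffs T). \<forall>i\<in>S. x i \<in> B}
      = measure (uniform_measure lborel {-1..1}) B ^ card S"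
proof -
  let ?u = "uniform_measure lborel {-1..1::real}"
  interpret u: prob_space ?u by (rule prob_space_unif)
  interpret P: finite_product_prob_space "\<lambda>_. ?u" T
    by unfold_locales (rule T)
  let ?X = "\<lambda>i. if i \<in> S then B else UNIV"
  have sp: "space (unif_coeffs T) = extensional T"
    by (auto simp: unif_coeffs_def space_PiM PiE_def)
  have eq: "{x \<in> space (unif_coeffs T). \<forall>i\<in>S. x i \<in> B} = PiE T ?X"
    unfolding sp using S by (auto simp: PiE_def Pi_def split: if_splits)
  show "{x \<in> space (unif_coeffs T). \<forall>i\<in>S. x i \<in> B} \<in> sets (unif_coeffs T)"
    unfolding eq using T B by (simp add: unif_coeffs_def sets_PiM_I_finite)
  have "measure (unif_coeffs T) (PiE T ?X) = (\<Prod>i\<in>T. measure ?u (?X i))"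
    unfolding unif_coeffs_def using B by (intro P.prob_times) auto
  also have "\<dots> = (\<Prod>i\<in>T. if i \<in> S then measure ?u B else 1)"
    using u.prob_space by (intro prod.cong) auto
  also have "\<dots> = (\<Prod>i\<in>T \<inter> S. measure ?u B)"
    by (rule prod.inter_restrict[OF T, symmetric])
  also have "\<dots> = measure ?u B ^ card S" using S by (simp add: Int_absorb1)
  finally show "measure (unif_coeffs T) {x \<in> space (unif_coeffs T). \<forall>i\<in>S. x i \<in> B}
      = measure ?u B ^ card S" unfolding eq .
qed

text \<open>A crude union bound over the sets of \<open>s\<close> coefficients; it suffices because \<open>a\<close> may be tiny.\<close>

lemma prob_few_small_coeffs:
  assumes T: "finite T" and a: "0 < a" "a \<le> 1" and s: "0 < s"
    and E: "E \<in> sets (unif_coeffs T)"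
    and good: "\<And>x. x \<in> space (unif_coeffs T) \<Longrightarrow> \<forall>i\<in>T. \<bar>x i\<bar> \<le> 1 \<Longrightarrow>
      card {i\<in>T. \<bar>x i\<bar> < a} < s \<Longrightarrow> x \<in> E"
  shows "1 - 2 ^ card T * a ^ s \<le> measure (unif_coeffs T) E"
proof -
  let ?\<mu> = "unif_coeffs T" and ?u = "uniform_measure lborel {-1..1::real}"
  interpret \<mu>: prob_space ?\<mu>
    unfolding unif_coeffs_def by (intro prob_space_PiM prob_space_unif)
  define A where "A S B = {x \<in> space ?\<mu>. \<forall>i\<in>S. x i \<in> B}" for S and B :: "real set"
  let ?\<S> = "{S. S \<subseteq> T \<and> card S = s}"
  have A_sets: "A S B \<in> sets ?\<mu>" if "S \<subseteq> T" "B \<in> sets borel" for S B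
    unfolding A_def using T that by (rule measure_unif_coeffs_box)
  have A_prob: "measure ?\<mu> (A S B) = measure ?u B ^ card S" if "S \<subseteq> T" "B \<in> sets borel" for S B
    unfolding A_def using T that by (rule measure_unif_coeffs_box)
  \<comment> \<open>Points with a coefficient outside \<open>[-1, 1]\<close> belong to the space but
    not to the scope of \<open>good\<close>; they form a null set, treated as a separate exceptional
    event.\<close>
  have u_out: "measure ?u (- {-1..1}) = 0"
    by (subst measure_uniform_measure) auto
  have "{-1..1} \<inter> {-a<..<a} = {-a<..<a}" using a by auto
  then have u_small: "measure ?u {-a<..<a} = a"
    using a by (subst measure_uniform_measure) auto
  let ?out = "\<Union>i\<in>T. A {i} (- {-1..1})" and ?small = "\<Union>S\<in>?\<S>. A S {-a<..<a}"
  have fin: "finite ?\<S>" using T by simp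
  have meas: "?out \<in> sets ?\<mu>" "?small \<in> sets ?\<mu>"
    using T fin by (auto intro!: sets.finite_UN A_sets)
  have "space ?\<mu> - E \<subseteq> ?out \<union> ?small"
  proof
    fix x assume x: "x \<in> space ?\<mu> - E"
    show "x \<in> ?out \<union> ?small"
    proof (cases "\<forall>i\<in>T. \<bar>x i\<bar> \<le> 1")
      case True
      then have "s \<le> card {i\<in>T. \<bar>x i\<bar> < a}" using good[of x] x by force
      then obtain S where "S \<subseteq> {i\<in>T. \<bar>x i\<bar> < a}" "card S = s"
        by (rule obtain_subset_with_card_n)
      then have "S \<in> ?\<S>" "x \<in> A S {-a<..<a}" using x by (auto simp: A_def abs_less_iff)
      then show ?thesis by blast
    next
      case False
      then obtain i where "i \<in> T" "\<not> \<bar>x i\<bar> \<le> 1" by blast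
      then have "x \<in> A {i} (- {-1..1})" using x by (auto simp: A_def abs_le_iff)
      then show ?thesis using \<open>i \<in> T\<close> by blast
    qed
  qed
  then have "measure ?\<mu> (space ?\<mu> - E) \<le> measure ?\<mu> (?out \<union> ?small)"
    using meas by (intro \<mu>.finite_measure_mono) auto
  also have "\<dots> \<le> measure ?\<mu> ?out + measure ?\<mu> ?small"
    using meas by (rule measure_Un_le)
  also have "measure ?\<mu> ?out \<le> (\<Sum>i\<in>T. measure ?\<mu> (A {i} (- {-1..1})))"
    using T by (intro \<mu>.finite_measure_subadditive_finite) (auto intro!: A_sets)
  also have "\<dots> = 0" using u_out by (simp add: A_prob)
  also have "measure ?\<mu> ?small \<le> (\<Sum>S\<in>?\<S>. measure ?\<mu> (A S {-a<..<a}))"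
    using fin by (intro \<mu>.finite_measure_subadditive_finite) (auto intro!: A_sets)
  also have "\<dots> = (\<Sum>S\<in>?\<S>. a ^ s)" using u_small by (intro sum.cong) (auto simp: A_prob)
  also have "\<dots> = card ?\<S> * a ^ s" by simp
  also have "\<dots> \<le> 2 ^ card T * a ^ s"
  proof (rule mult_right_mono)
    have "card ?\<S> \<le> card (Pow T)" using T by (intro card_mono) auto
    then show "real (card ?\<S>) \<le> 2 ^ card T" using T by (simp add: card_Pow flip: of_nat_power)
  qed (use a in auto)
  finally have "measure ?\<mu> (space ?\<mu> - E) \<le> 2 ^ card T * a ^ s" by simp
  then show ?thesis using \<mu>.prob_compl[OF E] by simp
qed

text \<open>Deterministic and valid for every run: randomness enters only through the number of
  small coefficients.\<close>

lemma omp_run_recovers: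
  fixes \<eta> a D r :: real
  assumes "dictionary M N \<Phi>" and T: "T \<subseteq> {..<N}" "card T = K"
    and "rip_const (2 * K) \<Phi> < \<delta>" "0 \<le> \<delta>" "\<delta> \<le> 1 / 4"
    and run: "omp_run \<Phi> (synth \<Phi> T x) \<phi> f"
    and abs_x: "\<forall>i\<in>T. \<bar>x i\<bar> \<le> 1" and small: "card {i\<in>T. \<bar>x i\<bar> < a} < s"
    and q: "1 \<le> q" "q + s \<le> k" "k \<le> K"
    and "\<delta> * (2 + K / q) \<le> \<eta>" "\<eta> \<le> a\<^sup>2 / 4" "0 < a" "a \<le> 1"
    and "real (q - 1) + 4 * \<eta> * K \<le> D * (a\<^sup>2 / 2)" "D + 1 \<le> K"
    and "real (128 * (k - 1)) \<le> r" "D + r \<le> K" "K + D + r \<le> n"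
  shows "f n = 0\<^sub>v M"
proof -
  have "0 < K" using q by linarith
  obtain idx c where
    gram: "gram_omp (\<lambda>i j. col \<Phi> i \<bullet> col \<Phi> j) N K \<delta> T (\<lambda>i. if i \<in> T then x i else 0) idx c"
    and f: "\<And>m. f m = comb \<Phi> (c m)"
    using omp_run_gram[OF assms(1) T \<open>0 < K\<close> assms(4-7)] by blast
  have \<Phi>: "\<Phi> \<in> carrier_mat M N" using assms(1) by (simp add: dictionary_def)
  have "{i\<in>T. \<bar>if i \<in> T then x i else 0\<bar> < a} = {i\<in>T. \<bar>x i\<bar> < a}" by auto
  then have "gram_form (\<lambda>i j. col \<Phi> i \<bullet> col \<Phi> j) N (c n) (c n) = 0"
    using abs_x small q assms(13-) by (intro gram_omp.recovery[OF gram]) auto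
  then have "f n \<bullet> f n = 0" unfolding gram_form_eq[OF \<Phi>] f .
  then show ?thesis using \<Phi> unfolding f by (intro scalar_prod_self_eq_0) auto
qed

theorem theorem1p1:
  shows "\<forall>\<epsilon>>0::real. \<exists>\<delta>>0::real. \<exists>K0::nat. \<exists>C>0::real.
    \<forall>K::nat. K \<ge> K0 \<longrightarrow>
      (\<forall>M N \<Phi> T. dictionary M N \<Phi> \<and> rip_const (2 * K) \<Phi> < \<delta> \<and> T \<subseteq> {..<N} \<and> card T = K \<longrightarrow>
        \<P>(x in unif_coeffs T.
            \<forall>\<phi> f. omp_run \<Phi> (synth \<Phi> T x) \<phi> f \<longrightarrow> f (nat \<lceil>real K * (1 + \<epsilon>)\<rceil>) = 0\<^sub>v M)
          > 1 - exp (- C * real K))"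
proof (intro allI impI)
  fix \<epsilon> :: real assume "0 < \<epsilon>"
  \<comment> \<open>Capping at 1 keeps the \<open>e * K / 4 + e * K / 8\<close> extra iterations
    within \<open>K\<close>.\<close>
  define e where "e = min \<epsilon> 1"
  \<comment> \<open>The final phase, with fewer than \<open>k\<close> missing indices, then takes at
    most \<open>128 * \<kappa> * K = e * K / 8\<close> iterations.\<close>
  define \<kappa> where "\<kappa> = e / 1024"
  \<comment> \<open>As \<open>s\<close> is at least \<open>\<kappa> * K / 4\<close>, this gives
    \<open>R * s \<ge> K\<close>; hence \<open>a ^ s\<close> is at most \<open>(1 / 4) ^ K\<close>
    and beats the union bound factor \<open>2 ^ K\<close>.\<close>
  define R where "R = nat \<lceil>4 / \<kappa>\<rceil>"
  define a :: real where "a = (1 / 4) ^ R"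
  \<comment> \<open>\<open>q\<close> is \<open>\<theta> * K\<close> rounded up. With
    \<open>D = e * K / 4\<close> wrong selections allowed, \<open>\<theta>\<close> and
    \<open>4 * \<eta>\<close> may each take half of \<open>e * a\<^sup>2 / 8\<close>.\<close>
  define \<theta> where "\<theta> = \<kappa> * a\<^sup>2 / 16"
  define \<eta> where "\<eta> = e * a\<^sup>2 / 64"
  \<comment> \<open>The factor 3 comes from \<open>2 + K / q \<le> 3 / \<theta>\<close>.\<close>
  define \<delta> where "\<delta> = \<theta> * \<eta> / 3"
  have e: "0 < e" "e \<le> 1" "e \<le> \<epsilon>" using \<open>0 < \<epsilon>\<close> by (auto simp: e_def)
  have \<kappa>: "0 < \<kappa>" "\<kappa> \<le> 1" using e by (auto simp: \<kappa>_def)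
  have a: "0 < a" "a \<le> 1" by (auto simp: a_def power_le_one)
  have a2: "0 < a\<^sup>2" "a\<^sup>2 \<le> 1" using a by (auto simp: power_le_one)
  have \<eta>: "0 < \<eta>" "\<eta> \<le> a\<^sup>2 / 4" using e a2 by (auto simp: \<eta>_def)
  have \<theta>: "0 < \<theta>" "\<theta> \<le> \<kappa> / 4" using \<kappa> a2 by (auto simp: \<theta>_def)
  have \<delta>: "0 < \<delta>" "\<delta> \<le> 1 / 4"
  proof -
    have "\<theta> * \<eta> \<le> (1 / 4) * (1 / 4)" using \<theta> \<eta> \<kappa> a2 by (intro mult_mono) auto
    then show "\<delta> \<le> 1 / 4" by (simp add: \<delta>_def)
  qed (use \<theta> \<eta> in \<open>simp add: \<delta>_def\<close>)
  \<comment> \<open>\<open>\<kappa> * K \<ge> 4\<close> absorbs the rounding of \<open>q\<close> and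
    \<open>s\<close> in \<open>q + s \<le> k\<close>.\<close>
  define K0 where "K0 = nat \<lceil>4 / \<kappa>\<rceil>"
  have main: "\<P>(x in unif_coeffs T.
      \<forall>\<phi> f. omp_run \<Phi> (synth \<Phi> T x) \<phi> f \<longrightarrow> f (nat \<lceil>real K * (1 + \<epsilon>)\<rceil>) = 0\<^sub>v M)
      > 1 - exp (- (1 / 2) * real K)"
    if K: "K0 \<le> K" and dict: "dictionary M N \<Phi>" and rip: "rip_const (2 * K) \<Phi> < \<delta>"
      and T: "T \<subseteq> {..<N}" "card T = K" for K M N \<Phi> T
  proof -
    define q where "q = nat \<lceil>\<theta> * K\<rceil>"
    define s where "s = nat \<lceil>\<kappa> * K / 4\<rceil>"
    define k where "k = nat \<lceil>\<kappa> * K\<rceil>"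
    let ?n = "nat \<lceil>real K * (1 + \<epsilon>)\<rceil>"
    let ?E = "{x \<in> space (unif_coeffs T). \<forall>\<phi> f. omp_run \<Phi> (synth \<Phi> T x) \<phi> f \<longrightarrow> f ?n = 0\<^sub>v M}"
    have "4 / \<kappa> \<le> K" using K unfolding K0_def by linarith
    then have \<kappa>K: "4 \<le> \<kappa> * K" using \<kappa> by (simp add: field_simps)
    then have "4 \<le> real K" using mult_right_mono[OF \<kappa>(2), of "real K"] by simp
    then have "0 < K" by simp
    have \<theta>K: "0 < \<theta> * K" "\<theta> * K \<le> \<kappa> * K / 4"
      using \<theta> \<open>0 < K\<close> mult_right_mono[OF \<theta>(2), of "real K"] by auto
    have q: "1 \<le> q" "\<theta> * K \<le> q" "real (q - 1) \<le> \<theta> * K" using \<theta>K unfolding q_def by linarith+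
    have s: "0 < s" "\<kappa> * K / 4 \<le> s" "s \<le> \<kappa> * K / 4 + 1" using \<kappa>K unfolding s_def by linarith+
    have k: "\<kappa> * K \<le> k" "real (k - 1) \<le> \<kappa> * K" using \<kappa>K unfolding k_def by linarith+
    have "\<kappa> * K \<le> K" using mult_right_mono[OF \<kappa>(2), of "real K"] by simp
    then have "k \<le> K" unfolding k_def by linarith
    have "real q + real s \<le> k" using q s k \<kappa>K \<theta>K by linarith
    then have "q + s \<le> k" by linarith
    have \<delta>\<eta>: "\<delta> * (2 + K / q) \<le> \<eta>"
    proof -
      have "K / q \<le> 1 / \<theta>" using q \<theta> \<open>0 < K\<close> by (simp add: field_simps)
      moreover have "1 \<le> 1 / \<theta>" using \<theta> \<kappa> by simp
      ultimately have "2 + K / q \<le> 3 / \<theta>" by simp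
      then have "\<delta> * (2 + K / q) \<le> \<delta> * (3 / \<theta>)" using \<delta> by (intro mult_left_mono) auto
      also have "\<dots> = \<eta>" using \<theta> by (simp add: \<delta>_def)
      finally show ?thesis .
    qed
    have wrong: "real (q - 1) + 4 * \<eta> * K \<le> (e * K / 4) * (a\<^sup>2 / 2)"
    proof -
      have "\<theta> \<le> e * a\<^sup>2 / 16" using e a2 by (simp add: \<theta>_def \<kappa>_def field_simps)
      then have "\<theta> * K \<le> (e * a\<^sup>2 / 16) * K" by (intro mult_right_mono) auto
      then show ?thesis using q(3) by (simp add: \<eta>_def mult_ac)
    qed
    have eK: "0 < e * K" "e * K \<le> K" "e * K \<le> K * \<epsilon>"
      using e \<open>0 < K\<close> mult_right_mono[OF e(2), of "real K"] mult_right_mono[OF e(3), of "real K"]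
      by (auto simp: mult.commute)
    have r: "real (128 * (k - 1)) \<le> e * K / 8" using k(2) by (simp add: \<kappa>_def)
    have D: "e * K / 4 + 1 \<le> K" "e * K / 4 + e * K / 8 \<le> K"
      using eK \<open>4 \<le> real K\<close> by linarith+
    have n: "K + e * K / 4 + e * K / 8 \<le> ?n"
    proof -
      have "K + e * K / 4 + e * K / 8 \<le> K + K * \<epsilon>" using eK by linarith
      also have "\<dots> = K * (1 + \<epsilon>)" by (simp add: algebra_simps)
      finally show ?thesis by linarith
    qed
    have \<Phi>: "\<Phi> \<in> carrier_mat M N" "0 < N" using dict by (auto simp: dictionary_def)
    have "1 - 2 ^ card T * a ^ s \<le> measure (unif_coeffs T) ?E"
    proof (rule prob_few_small_coeffs[OF _ a s(1) measurable_recovery_event[OF \<Phi> T(1)]])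
      show "finite T" using T(1) finite_subset by blast
      fix x assume x: "x \<in> space (unif_coeffs T)" "\<forall>i\<in>T. \<bar>x i\<bar> \<le> 1" "card {i\<in>T. \<bar>x i\<bar> < a} < s"
      have "f ?n = 0\<^sub>v M" if "omp_run \<Phi> (synth \<Phi> T x) \<phi> f" for \<phi> f
        using omp_run_recovers[OF dict T rip less_imp_le[OF \<delta>(1)] \<delta>(2) that x(2,3) q(1) \<open>q + s \<le> k\<close>
            \<open>k \<le> K\<close> \<delta>\<eta> \<eta>(2) a wrong D(1) r D(2) n] .
      then show "x \<in> ?E" using x(1) by blast
    qed
    moreover have "2 ^ card T * a ^ s < exp (- (1 / 2) * real K)"
    proof -
      have "4 / \<kappa> \<le> R" unfolding R_def by linarith
      then have "(4 / \<kappa>) * (\<kappa> * K / 4) \<le> real R * s" using s(2) \<kappa> by (intro mult_mono) auto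
      then have "real K \<le> real (R * s)" using \<kappa> by simp
      then have "K \<le> R * s" by linarith
      then have "a ^ s \<le> (1 / 4) ^ K"
        unfolding a_def power_mult[symmetric] by (intro power_decreasing) auto
      then have "2 ^ card T * a ^ s \<le> 2 ^ K * (1 / 4) ^ K" unfolding T(2) by (intro mult_left_mono) auto
      also have "\<dots> = (1 / 2) ^ K" by (simp flip: power_mult_distrib)
      \<comment> \<open>This holds because \<open>exp 1 \<le> 3 < 4\<close>; the rate
        \<open>1 / 2\<close> serves every \<open>\<epsilon>\<close>.\<close>
      also have "\<dots> < exp (- (1 / 2)) ^ K"
      proof (rule power_strict_mono)
        have "exp (1 / 2 :: real) * exp (1 / 2) < 2 * 2"
          using exp_le by (simp flip: exp_add)
        then have "exp (1 / 2 :: real) < 2"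
          by (meson exp_ge_zero mult_mono not_less zero_le_numeral)
        then show "1 / 2 < exp (- (1 / 2) :: real)" by (simp add: exp_minus field_simps)
      qed (use \<open>0 < K\<close> in auto)
      also have "\<dots> = exp (- (1 / 2) * real K)" by (simp add: exp_of_nat_mult[symmetric] mult.commute)
      finally show ?thesis .
    qed
    ultimately show ?thesis by simp
  qed
  show "\<exists>\<delta>>0::real. \<exists>K0::nat. \<exists>C>0::real.
    \<forall>K::nat. K \<ge> K0 \<longrightarrow>
      (\<forall>M N \<Phi> T. dictionary M N \<Phi> \<and> rip_const (2 * K) \<Phi> < \<delta> \<and> T \<subseteq> {..<N} \<and> card T = K \<longrightarrow>
        \<P>(x in unif_coeffs T.
            \<forall>\<phi> f. omp_run \<Phi> (synth \<Phi> T x) \<phi> f \<longrightarrow> f (nat \<lceil>real K * (1 + \<epsilon>)\<rceil>) = 0\<^sub>v M)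
          > 1 - exp (- C * real K))"
    using \<delta>(1) main
    by (intro exI[of _ \<delta>] exI[of _ K0] exI[of _ "1 / 2 :: real"] conjI) auto
qed

end
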